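(* Let $(X,d)$ be a complete length space and $T>0$. Assume that $f:X\to\mathbb{R}$ is bounded and uniformly continuous. Let $u_0:X\to\mathbb{R}$ be bounded and Lipschitz and let $u\in C(X\times[0,T))$ satisfy $\sup_{x\in X}|u(x,t)-u_0(x)|\to0$ as $t\to0+$. Then $u$ is a Monge solution of $$\partial_tu+|\nabla u|=f(x)\quad\text{in }X\times(0,T)$$ if and only if it is a slope-based viscosity solution of this equation.
   Context: Write $Y_T=X\times(0,T)$. Monge solutions. For $k\ge0$, $S_k(Y_T)$ is the set of locally Lipschitz $u:Y_T\to\mathbb{R}$ with $u(x,t)-u(x,s)\ge-k(t-s)$ for all $x\in X$, $0<s<t<T$; $S(Y_T)=\bigcup_{k\ge0}S_k(Y_T)$. For $v\in S_0(Y_T)$, $$|D^-v|(x,t)=\limsup_{\delta\to0+}\ \sup\left\{\frac{v(x,t)-v(y,t-\delta)}{\delta}:y\in X,\ d(x,y)\le\delta\right\}.$$ $u$ is a Monge solution if $u\in S(Y_T)$ (restricted to $Y_T$) and there is $k\ge0$ with $k+\inf_Xf\ge0$ and $u\in S_k(Y_T)$ such that $v(x,t)=u(x,t)+kt$ satisfies $|D^-v|(x,t)=f(x)+k$ for all $(x,t)\in Y_T$. Slope-based solutions. Put $H(x,p)=p-f(x)$ for $p\ge0$ and $H(x,p)=H(x,0)$ for $p<0$; for $r\ge0$ let $H_r(x,p)=\inf_{|q-p|\le r}H(x,q)$, $H^r(x,p)=\sup_{|q-p|\le r}H(x,q)$. For a function $\psi$ on $Y_T$, $|\nabla\psi|(x,t)=\limsup_{y\to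 x}\frac{|\psi(x,t)-\psi(y,t)|}{d(x,y)}$ and $|\nabla^-\psi|(x,t)=\limsup_{y\to x}\frac{\max\{\psi(x,t)-\psi(y,t),0\}}{d(x,y)}$. The class $\underline{\mathcal C}$ of subsolution test functions consists of $\psi=\psi_1+\psi_2$ with $\psi_1,\psi_2$ locally Lipschitz on $Y_T$, $|\nabla\psi_1|=|\nabla^-\psi_1|$ continuous, and $\partial_t\psi_1,\partial_t\psi_2$ continuous. The class $\overline{\mathcal C}$ of supersolution test functions consists of $\psi=\psi_1+\psi_2$ with $-\psi=(-\psi_1)+(-\psi_2)\in\underline{\mathcal C}$ via this decomposition. $g^*(x,t)=\limsup_{(y,s)\to(x,t)}g(y,s)$ is the upper semicontinuous envelope. A locally bounded upper semicontinuous $u:Y_T\to\mathbb{R}$ is a slope-based viscosity subsolution if $\partial_t\psi(x,t)+H_{|\nabla\psi_2|^*(x,t)}(x,|\nabla\psi_1|(x,t))\le0$ whenever $u-\psi$ has a local maximum at $(x,t)\in Y_T$ with $\psi\in\underline{\mathcal C}$. A locally bounded lower semicontinuous $u$ is a slope-based viscosity supersolution if $\partial_t\psi(x,t)+H^{|\nabla\psi_2|^*(x,t)}(x,|\nabla\psi_1|(x,t))\ge0$ whenever $u-\psi$ has a local minimum at $(x,t)\in Y_T$ with $\psi\in\overline{\mathcal C}$. A continuous $u$ is a slope-based viscosity solution if it is both. *)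

theory Defs
  imports "HOL-Analysis.Analysis"
begin

section \<open>Length spaces\<close>

definition curve_length :: "(real \<Rightarrow> 'a::metric_space) \<Rightarrow> ereal" where
  "curve_length g =
     (SUP ts\<in>{ts. sorted ts \<and> set ts \<subseteq> {0..1}}.
        ereal (\<Sum>i<length ts - 1. dist (g (ts ! i)) (g (ts ! Suc i))))"

text \<open>The infimum over the empty set is \<open>\<infinity>\<close>, so this forces any two points to be joined
  by a rectifiable curve.\<close>

definition is_length_space :: "'a::metric_space itself \<Rightarrow> bool" where
  "is_length_space _ \<longleftrightarrow>
     (\<forall>x y::'a. ereal (dist x y) =
        (INF g\<in>{g. path g \<and> pathstart g = x \<and> pathfinish g = y}. curve_length g))"

section \<open>Functions on the space-time cylinder\<close>

text \<open>Functions on \<open>Y\<^sub>T = X \<times> (0,T)\<close> are represented by total functions on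
  \<open>X \<times> \<real>\<close>; no definition below depends on their values outside \<open>Y\<^sub>T\<close>.\<close>

definition cyl :: "real \<Rightarrow> ('a::metric_space \<times> real) set" where
  "cyl T = UNIV \<times> {0<..<T}"

definition locally_lipschitz_on ::
    "'a::metric_space set \<Rightarrow> ('a \<Rightarrow> real) \<Rightarrow> bool" where
  "locally_lipschitz_on S u \<longleftrightarrow>
     (\<forall>z\<in>S. \<exists>r>0. \<exists>L. L-lipschitz_on (ball z r \<inter> S) u)"

definition locally_bounded_on ::
    "'a::metric_space set \<Rightarrow> ('a \<Rightarrow> real) \<Rightarrow> bool" where
  "locally_bounded_on S u \<longleftrightarrow> (\<forall>z\<in>S. \<exists>r>0. bounded (u ` (ball z r \<inter> S)))"

definition usc_on :: "'a::metric_space set \<Rightarrow> ('a \<Rightarrow> real) \<Rightarrow> bool" where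
  "usc_on S u \<longleftrightarrow> (\<forall>z\<in>S. Limsup (at z within S) (\<lambda>w. ereal (u w)) \<le> ereal (u z))"

definition lsc_on :: "'a::metric_space set \<Rightarrow> ('a \<Rightarrow> real) \<Rightarrow> bool" where
  "lsc_on S u \<longleftrightarrow> (\<forall>z\<in>S. ereal (u z) \<le> Liminf (at z within S) (\<lambda>w. ereal (u w)))"

section \<open>Monge solutions\<close>

definition monge_class_k ::
    "real \<Rightarrow> real \<Rightarrow> ('a::metric_space \<times> real \<Rightarrow> real) set" where
  "monge_class_k T k = {u. locally_lipschitz_on (cyl T) u \<and>
     (\<forall>x s t. 0 < s \<and> s < t \<and> t < T \<longrightarrow> u (x, t) - u (x, s) \<ge> - k * (t - s))}"

definition monge_class :: "real \<Rightarrow> ('a::metric_space \<times> real \<Rightarrow> real) set" where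
  "monge_class T = (\<Union>k\<in>{0..}. monge_class_k T k)"

definition Dminus :: "('a::metric_space \<times> real \<Rightarrow> real) \<Rightarrow> 'a \<Rightarrow> real \<Rightarrow> ereal" where
  "Dminus v x t = Limsup (at_right 0)
     (\<lambda>\<delta>. SUP y\<in>cball x \<delta>. ereal ((v (x, t) - v (y, t - \<delta>)) / \<delta>))"

definition monge_solution ::
    "real \<Rightarrow> ('a::metric_space \<Rightarrow> real) \<Rightarrow> ('a \<times> real \<Rightarrow> real) \<Rightarrow> bool" where
  "monge_solution T f u \<longleftrightarrow> u \<in> monge_class T \<and>
     (\<exists>k\<ge>0. k + (INF x. f x) \<ge> 0 \<and> u \<in> monge_class_k T k \<and>
        (\<forall>x. \<forall>t\<in>{0<..<T}.
           Dminus (\<lambda>(y, s). u (y, s) + k * s) x t = ereal (f x + k)))"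

section \<open>Slope-based viscosity solutions\<close>

text \<open>The slopes are used only for functions that are locally Lipschitz on \<open>Y\<^sub>T\<close>, where the
  upper limits are finite unless \<open>x\<close> is isolated. At an isolated point \<open>at x\<close> is the trivial
  filter, the upper limit is \<open>-\<infinity>\<close>, and \<open>real_of_ereal\<close> turns it into the usual
  convention that the slope is \<open>0\<close> there; in a length space this occurs only if the space is
  a single point.\<close>

definition slope :: "('a::metric_space \<times> real \<Rightarrow> real) \<Rightarrow> 'a \<times> real \<Rightarrow> real" where
  "slope \<psi> = (\<lambda>(x, t). real_of_ereal
     (Limsup (at x) (\<lambda>y. ereal (\<bar>\<psi> (x, t) - \<psi> (y, t)\<bar> / dist x y))))"

definition descending_slope ::
    "('a::metric_space \<times> real \<Rightarrow> real) \<Rightarrow> 'a \<times> real \<Rightarrow> real" where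
  "descending_slope \<psi> = (\<lambda>(x, t). real_of_ereal
     (Limsup (at x) (\<lambda>y. ereal (max (\<psi> (x, t) - \<psi> (y, t)) 0 / dist x y))))"

text \<open>The filter is \<open>nhds z\<close> rather than \<open>at z\<close>: the value at \<open>z\<close> itself counts. It is applied
  to \<open>slope \<psi>\<close> with \<open>\<psi>\<close> locally Lipschitz and \<open>z\<close> in the open set \<open>Y\<^sub>T\<close>, where the upper limit
  is finite.\<close>

definition usc_envelope :: "('a::topological_space \<Rightarrow> real) \<Rightarrow> 'a \<Rightarrow> real" where
  "usc_envelope g z = real_of_ereal (Limsup (nhds z) (\<lambda>w. ereal (g w)))"

definition dt :: "('a \<times> real \<Rightarrow> real) \<Rightarrow> 'a \<times> real \<Rightarrow> real" where
  "dt \<psi> = (\<lambda>(x, t). deriv (\<lambda>s. \<psi> (x, s)) t)"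

definition continuous_dt_on_cyl ::
    "real \<Rightarrow> ('a::metric_space \<times> real \<Rightarrow> real) \<Rightarrow> bool" where
  "continuous_dt_on_cyl T \<psi> \<longleftrightarrow>
     (\<forall>x. \<forall>t\<in>{0<..<T}. (\<lambda>s. \<psi> (x, s)) field_differentiable (at t)) \<and>
     continuous_on (cyl T) (dt \<psi>)"

definition hamil :: "('a \<Rightarrow> real) \<Rightarrow> 'a \<Rightarrow> real \<Rightarrow> real" where
  "hamil f x p = (if p \<ge> 0 then p - f x else 0 - f x)"

definition hamil_lower :: "('a \<Rightarrow> real) \<Rightarrow> real \<Rightarrow> 'a \<Rightarrow> real \<Rightarrow> real" where
  "hamil_lower f r x p = (INF q\<in>{q. \<bar>q - p\<bar> \<le> r}. hamil f x q)"

definition hamil_upper :: "('a \<Rightarrow> real) \<Rightarrow> real \<Rightarrow> 'a \<Rightarrow> real \<Rightarrow> real" where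
  "hamil_upper f r x p = (SUP q\<in>{q. \<bar>q - p\<bar> \<le> r}. hamil f x q)"

text \<open>A test function is given together with its decomposition \<open>\<psi> = \<psi>\<^sub>1 + \<psi>\<^sub>2\<close>, on which the
  inequalities for sub- and supersolutions depend.\<close>

definition sub_test ::
    "real \<Rightarrow> ('a::metric_space \<times> real \<Rightarrow> real) \<Rightarrow> ('a \<times> real \<Rightarrow> real) \<Rightarrow> bool" where
  "sub_test T \<psi>1 \<psi>2 \<longleftrightarrow>
     locally_lipschitz_on (cyl T) \<psi>1 \<and> locally_lipschitz_on (cyl T) \<psi>2 \<and>
     (\<forall>z\<in>cyl T. slope \<psi>1 z = descending_slope \<psi>1 z) \<and>
     continuous_on (cyl T) (slope \<psi>1) \<and>
     continuous_dt_on_cyl T \<psi>1 \<and> continuous_dt_on_cyl T \<psi>2"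

definition super_test ::
    "real \<Rightarrow> ('a::metric_space \<times> real \<Rightarrow> real) \<Rightarrow> ('a \<times> real \<Rightarrow> real) \<Rightarrow> bool" where
  "super_test T \<psi>1 \<psi>2 \<longleftrightarrow> sub_test T (\<lambda>z. - \<psi>1 z) (\<lambda>z. - \<psi>2 z)"

definition has_local_max_at ::
    "'a::metric_space set \<Rightarrow> ('a \<Rightarrow> real) \<Rightarrow> 'a \<Rightarrow> bool" where
  "has_local_max_at S g z \<longleftrightarrow> (\<forall>\<^sub>F w in at z within S. g w \<le> g z)"

definition has_local_min_at ::
    "'a::metric_space set \<Rightarrow> ('a \<Rightarrow> real) \<Rightarrow> 'a \<Rightarrow> bool" where
  "has_local_min_at S g z \<longleftrightarrow> (\<forall>\<^sub>F w in at z within S. g z \<le> g w)"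

definition slope_subsolution ::
    "real \<Rightarrow> ('a::metric_space \<Rightarrow> real) \<Rightarrow> ('a \<times> real \<Rightarrow> real) \<Rightarrow> bool" where
  "slope_subsolution T f u \<longleftrightarrow>
     locally_bounded_on (cyl T) u \<and> usc_on (cyl T) u \<and>
     (\<forall>\<psi>1 \<psi>2 x. \<forall>t\<in>{0<..<T}.
        sub_test T \<psi>1 \<psi>2 \<and>
        has_local_max_at (cyl T) (\<lambda>z. u z - (\<psi>1 z + \<psi>2 z)) (x, t) \<longrightarrow>
        dt (\<lambda>z. \<psi>1 z + \<psi>2 z) (x, t) +
          hamil_lower f (usc_envelope (slope \<psi>2) (x, t)) x (slope \<psi>1 (x, t)) \<le> 0)"

definition slope_supersolution ::
    "real \<Rightarrow> ('a::metric_space \<Rightarrow> real) \<Rightarrow> ('a \<times> real \<Rightarrow> real) \<Rightarrow> bool" where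
  "slope_supersolution T f u \<longleftrightarrow>
     locally_bounded_on (cyl T) u \<and> lsc_on (cyl T) u \<and>
     (\<forall>\<psi>1 \<psi>2 x. \<forall>t\<in>{0<..<T}.
        super_test T \<psi>1 \<psi>2 \<and>
        has_local_min_at (cyl T) (\<lambda>z. u z - (\<psi>1 z + \<psi>2 z)) (x, t) \<longrightarrow>
        dt (\<lambda>z. \<psi>1 z + \<psi>2 z) (x, t) +
          hamil_upper f (usc_envelope (slope \<psi>2) (x, t)) x (slope \<psi>1 (x, t)) \<ge> 0)"

definition slope_solution ::
    "real \<Rightarrow> ('a::metric_space \<Rightarrow> real) \<Rightarrow> ('a \<times> real \<Rightarrow> real) \<Rightarrow> bool" where
  "slope_solution T f u \<longleftrightarrow>
     continuous_on (cyl T) u \<and> slope_subsolution T f u \<and> slope_supersolution T f u"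

end

theory Submission
  imports Defs
begin

text \<open>
  Both notions of solution express that \<open>u\<close> is the value function of the control problem in which a
  point moves backwards in time at speed at most one and pays the running cost \<open>f\<close>. The constant in
  the definition of a Monge solution cancels, and what has to be compared with the viscosity
  inequalities is the equation \<open>Dminus u x t = f x\<close>: no step of length at most \<open>\<delta>\<close> in time \<open>\<delta>\<close> is
  cheaper, up to \<open>o(\<delta>)\<close>, than \<open>u\<close> predicts, and some steps realise the prediction.

  From this equation the viscosity inequalities follow at every point by expanding the test function
  to first order along such steps (\<open>subsolution_inequality_of_Dminus_le\<close>,
  \<open>supersolution_inequality_of_le_Dminus\<close>).

  Conversely, a subsolution satisfies the dynamic programming inequality along all short motions of
  speed at most one, and a supersolution nearly attains it along some short motion
  (\<open>subsolution_le_along_motion\<close>, \<open>supersolution_ge_along_some_motion\<close>). Both are local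
  comparison arguments with smoothed light cones. In a length space a nondecreasing function of the
  distance to a point, flat at that point, has equal slope and descending slope, so these cones are
  admissible as first part of a test function. Maxima over non-compact balls are replaced by almost
  maxima in the sense of Ekeland, and the Ekeland perturbation is the second part of the test
  function.

  The local estimates give \<open>Dminus u x t \<le> f x\<close> at once. The other inequality and the local
  Lipschitz continuity also need a lower bound \<open>u (x, t) - u (x, s) \<ge> - k (t - s)\<close>, which
  moreover is part of being a Monge solution. This is a global statement, and it is the place where
  the initial data enter (\<open>time_lower_bound\<close>): the local steps of the supersolution are chained
  backwards to the initial time, and the subsolution property is used along the same chain at
  shifted times. The chain exists by completeness, through the same principle on closed preorders
  (\<open>closed_preorder_maximal_element\<close>) that gives the almost maxima; it copes with steps whose
  sizes have no uniform lower bound.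
\<close>

section \<open>Upper limits\<close>

lemma Limsup_le_ereal_iff:
  "Limsup F X \<le> ereal c \<longleftrightarrow> (\<forall>e>0. \<forall>\<^sub>F x in F. X x \<le> ereal (c + e))"
proof
  assume "Limsup F X \<le> ereal c"
  then have *: "\<forall>y>ereal c. \<forall>\<^sub>F x in F. X x < y"
    by (simp add: Limsup_le_iff)
  show "\<forall>e>0. \<forall>\<^sub>F x in F. X x \<le> ereal (c + e)"
  proof (intro allI impI)
    fix e :: real assume "e > 0"
    then have "\<forall>\<^sub>F x in F. X x < ereal (c + e)" using * by simp
    then show "\<forall>\<^sub>F x in F. X x \<le> ereal (c + e)" by (rule eventually_mono) simp
  qed
next
  assume R: "\<forall>e>0. \<forall>\<^sub>F x in F. X x \<le> ereal (c + e)"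
  show "Limsup F X \<le> ereal c"
  proof (rule ereal_le_epsilon2)
    fix e :: real assume "0 < e"
    then show "Limsup F X \<le> ereal c + ereal e"
      using R by (auto intro!: Limsup_bounded)
  qed
qed

lemma ereal_le_Limsup_iff:
  "ereal c \<le> Limsup F X \<longleftrightarrow> (\<forall>e>0. \<exists>\<^sub>F x in F. ereal (c - e) < X x)"
proof
  assume L: "ereal c \<le> Limsup F X"
  show "\<forall>e>0. \<exists>\<^sub>F x in F. ereal (c - e) < X x"
  proof (intro allI impI)
    fix e :: real assume "e > 0"
    show "\<exists>\<^sub>F x in F. ereal (c - e) < X x"
    proof (rule ccontr)
      assume "\<not> ?thesis"
      then have "\<forall>\<^sub>F x in F. X x \<le> ereal (c - e)" by (simp add: not_frequently not_less)
      then have "Limsup F X \<le> ereal (c - e)" by (rule Limsup_bounded)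
      with L have "ereal c \<le> ereal (c - e)" by (rule order_trans)
      with \<open>e > 0\<close> show False by simp
    qed
  qed
next
  assume R: "\<forall>e>0. \<exists>\<^sub>F x in F. ereal (c - e) < X x"
  show "ereal c \<le> Limsup F X"
  proof (rule ccontr)
    assume "\<not> ?thesis"
    then obtain d where d: "Limsup F X < ereal d" "d < c"
      using ereal_dense2[of "Limsup F X" "ereal c"] by (auto simp: not_le)
    have "\<exists>\<^sub>F x in F. ereal (c - (c - d)) < X x"
      using R d by (metis diff_gt_0_iff_gt)
    moreover have "\<forall>\<^sub>F x in F. X x < ereal d" using d(1) by (intro Limsup_lessD)
    ultimately have "\<exists>\<^sub>F x in F. ereal (c - (c - d)) < X x \<and> X x < ereal d"
      by (rule frequently_eventually_frequently)
    then show False by (auto dest!: frequently_ex)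
  qed
qed

text \<open>The slopes and the semicontinuous envelope apply \<^const>\<open>real_of_ereal\<close> to an upper limit. For
  bounded nonnegative functions this loses nothing, and the trivial filter, which is the filter at
  an isolated point, gives the value \<open>0\<close>; the following lemmas let both cases be treated alike.\<close>

lemma real_Limsup_nonneg:
  assumes "\<And>x. 0 \<le> (g x :: real)"
  shows "0 \<le> real_of_ereal (Limsup F (\<lambda>x. ereal (g x)))"
proof (cases "F = bot")
  case False
  then have "0 \<le> Limsup F (\<lambda>x. ereal (g x))"
    using assms by (intro le_Limsup) auto
  then show ?thesis by (simp add: real_of_ereal_pos)
qed (simp add: bot_ereal_def)

lemma real_Limsup_le:
  assumes "\<And>x. 0 \<le> (g x :: real)" "\<forall>\<^sub>F x in F. g x \<le> L" "0 \<le> L"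
  shows "real_of_ereal (Limsup F (\<lambda>x. ereal (g x))) \<le> L"
proof (cases "F = bot")
  case False
  have "0 \<le> Limsup F (\<lambda>x. ereal (g x))"
    using assms False by (intro le_Limsup) auto
  moreover have "Limsup F (\<lambda>x. ereal (g x)) \<le> ereal L"
    using assms(2) by (intro Limsup_bounded) auto
  ultimately show ?thesis using assms(3)
    by (cases "Limsup F (\<lambda>x. ereal (g x))") auto
qed (simp add: bot_ereal_def assms)

lemma ereal_real_Limsup:
  assumes "F \<noteq> bot" "\<And>x. 0 \<le> (g x :: real)" "\<forall>\<^sub>F x in F. g x \<le> L"
  shows "ereal (real_of_ereal (Limsup F (\<lambda>x. ereal (g x)))) = Limsup F (\<lambda>x. ereal (g x))"
proof -
  have "0 \<le> Limsup F (\<lambda>x. ereal (g x))"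
    using assms by (intro le_Limsup) auto
  moreover have "Limsup F (\<lambda>x. ereal (g x)) \<le> ereal L"
    using assms(3) by (intro Limsup_bounded) auto
  ultimately show ?thesis
    by (cases "Limsup F (\<lambda>x. ereal (g x))") auto
qed

lemma eventually_le_real_Limsup:
  assumes "\<And>x. 0 \<le> (g x :: real)" "\<forall>\<^sub>F x in F. g x \<le> L" "e > 0"
  shows "\<forall>\<^sub>F x in F. g x \<le> real_of_ereal (Limsup F (\<lambda>x. ereal (g x))) + e"
proof (cases "F = bot")
  case False
  have "Limsup F (\<lambda>x. ereal (g x)) \<le> ereal (real_of_ereal (Limsup F (\<lambda>x. ereal (g x))))"
    using ereal_real_Limsup[OF False assms(1,2)] by simp
  then have "\<forall>e>0. \<forall>\<^sub>F x in F. ereal (g x)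
      \<le> ereal (real_of_ereal (Limsup F (\<lambda>x. ereal (g x))) + e)"
    by (simp only: Limsup_le_ereal_iff)
  then show ?thesis using assms(3) by simp
qed simp

lemma frequently_ge_real_Limsup:
  assumes "F \<noteq> bot" "\<And>x. 0 \<le> (g x :: real)" "\<forall>\<^sub>F x in F. g x \<le> L" "e > 0"
  shows "\<exists>\<^sub>F x in F. real_of_ereal (Limsup F (\<lambda>x. ereal (g x))) - e < g x"
proof -
  have "ereal (real_of_ereal (Limsup F (\<lambda>x. ereal (g x)))) \<le> Limsup F (\<lambda>x. ereal (g x))"
    using ereal_real_Limsup[OF assms(1-3)] by simp
  then have "\<forall>e>0. \<exists>\<^sub>F x in F. ereal (real_of_ereal (Limsup F (\<lambda>x. ereal (g x))) - e)
      < ereal (g x)"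
    by (simp only: ereal_le_Limsup_iff)
  then show ?thesis using assms(4) by simp
qed

lemma le_real_Limsup:
  assumes "\<And>x. 0 \<le> (g x :: real)" "\<forall>\<^sub>F x in F. g x \<le> L"
    and "\<And>e. e > 0 \<Longrightarrow> \<exists>\<^sub>F x in F. c - e < g x"
  shows "c \<le> real_of_ereal (Limsup F (\<lambda>x. ereal (g x)))"
proof -
  have "F \<noteq> bot" using assms(3)[of 1] by (auto simp: frequently_def)
  moreover have "ereal c \<le> Limsup F (\<lambda>x. ereal (g x))"
    unfolding ereal_le_Limsup_iff using assms(3) by simp
  ultimately show ?thesis
    using ereal_real_Limsup[of F g L] assms(1,2) by (metis ereal_less_eq(3))
qed

section \<open>The backward unit-speed derivative\<close>

lemma Dminus_le_iff:
  fixes v :: "'a::metric_space \<times> real \<Rightarrow> real"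
  shows "Dminus v x t \<le> ereal c \<longleftrightarrow> (\<forall>e>0. \<forall>\<^sub>F \<delta> in at_right 0.
           \<forall>y\<in>cball x \<delta>. v (x, t) - v (y, t - \<delta>) \<le> (c + e) * \<delta>)"
proof -
  have "(\<forall>\<^sub>F \<delta> in at_right 0.
           (SUP y\<in>cball x \<delta>. ereal ((v (x, t) - v (y, t - \<delta>)) / \<delta>)) \<le> ereal (c + e)) \<longleftrightarrow>
        (\<forall>\<^sub>F \<delta> in at_right 0. \<forall>y\<in>cball x \<delta>. v (x, t) - v (y, t - \<delta>) \<le> (c + e) * \<delta>)" for e
  proof (rule eventually_cong)
    show "\<forall>\<^sub>F \<delta> in at_right (0::real). \<delta> > 0" by (rule eventually_at_right_less)
  next
    fix \<delta> :: real assume "\<delta> > 0"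
    then show "((SUP y\<in>cball x \<delta>. ereal ((v (x, t) - v (y, t - \<delta>)) / \<delta>)) \<le> ereal (c + e)) =
      (\<forall>y\<in>cball x \<delta>. v (x, t) - v (y, t - \<delta>) \<le> (c + e) * \<delta>)"
      by (simp add: SUP_le_iff pos_divide_le_eq)
  qed
  then show ?thesis
    unfolding Dminus_def Limsup_le_ereal_iff by simp
qed

lemma le_Dminus_iff:
  fixes v :: "'a::metric_space \<times> real \<Rightarrow> real"
  shows "ereal c \<le> Dminus v x t \<longleftrightarrow> (\<forall>e>0. \<exists>\<^sub>F \<delta> in at_right 0.
           \<exists>y\<in>cball x \<delta>. (c - e) * \<delta> < v (x, t) - v (y, t - \<delta>))"
proof -
  have "(\<exists>\<^sub>F \<delta> in at_right 0.
           ereal (c - e) < (SUP y\<in>cball x \<delta>. ereal ((v (x, t) - v (y, t - \<delta>)) / \<delta>))) \<longleftrightarrow>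
        (\<exists>\<^sub>F \<delta> in at_right 0. \<exists>y\<in>cball x \<delta>. (c - e) * \<delta> < v (x, t) - v (y, t - \<delta>))" for e
  proof (rule frequently_cong)
    show "\<forall>\<^sub>F \<delta> in at_right (0::real). \<delta> > 0" by (rule eventually_at_right_less)
  next
    fix \<delta> :: real assume "\<delta> > 0"
    then show "(ereal (c - e) < (SUP y\<in>cball x \<delta>. ereal ((v (x, t) - v (y, t - \<delta>)) / \<delta>))) =
      (\<exists>y\<in>cball x \<delta>. (c - e) * \<delta> < v (x, t) - v (y, t - \<delta>))"
      by (simp add: less_SUP_iff pos_less_divide_eq)
  qed
  then show ?thesis
    unfolding Dminus_def ereal_le_Limsup_iff by simp
qed

text \<open>Adding a multiple of time shifts the backward derivative by that multiple, so the constant \<open>k\<close>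
  in the definition of a Monge solution disappears from the equation: what remains of it is
  \<open>Dminus u x t = f x\<close>.\<close>

lemma Dminus_add_linear_le_iff:
  fixes u :: "'a::metric_space \<times> real \<Rightarrow> real"
  shows "Dminus (\<lambda>(y, s). u (y, s) + k * s) x t \<le> ereal (c + k) \<longleftrightarrow> Dminus u x t \<le> ereal c"
  unfolding Dminus_le_iff by (simp add: algebra_simps)

lemma le_Dminus_add_linear_iff:
  fixes u :: "'a::metric_space \<times> real \<Rightarrow> real"
  shows "ereal (c + k) \<le> Dminus (\<lambda>(y, s). u (y, s) + k * s) x t \<longleftrightarrow> ereal c \<le> Dminus u x t"
  unfolding le_Dminus_iff by (simp add: algebra_simps)

section \<open>Slopes\<close>

lemma cylI: "0 < t \<Longrightarrow> t < T \<Longrightarrow> (x, t) \<in> cyl T"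
  by (simp add: cyl_def)

lemma open_cyl: "open (cyl T)"
  unfolding cyl_def by (intro open_Times) auto

lemma locally_lipschitz_on_cylD:
  fixes \<psi> :: "'a::metric_space \<times> real \<Rightarrow> real"
  assumes "locally_lipschitz_on (cyl T) \<psi>" "z \<in> cyl T"
  obtains r L where "r > 0" "0 \<le> L" "ball z r \<subseteq> cyl T"
    "\<And>w w'. w \<in> ball z r \<Longrightarrow> w' \<in> ball z r \<Longrightarrow> \<bar>\<psi> w - \<psi> w'\<bar> \<le> L * dist w w'"
proof -
  obtain r1 L where r1: "r1 > 0" "L-lipschitz_on (ball z r1 \<inter> cyl T) \<psi>"
    using assms unfolding locally_lipschitz_on_def by blast
  obtain r2 where r2: "r2 > 0" "ball z r2 \<subseteq> cyl T"
    using open_cyl assms(2) by (meson openE)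
  show ?thesis
  proof (rule that[of "min r1 r2" L])
    show "0 \<le> L" using r1(2) by (rule lipschitz_on_nonneg)
    show "ball z (min r1 r2) \<subseteq> cyl T" using r2 by auto
    show "\<bar>\<psi> w - \<psi> w'\<bar> \<le> L * dist w w'"
      if "w \<in> ball z (min r1 r2)" "w' \<in> ball z (min r1 r2)" for w w'
    proof -
      have "w \<in> ball z r1 \<inter> cyl T" "w' \<in> ball z r1 \<inter> cyl T" using that r2 by auto
      then have "dist (\<psi> w) (\<psi> w') \<le> L * dist w w'" by (rule lipschitz_onD[OF r1(2)])
      then show ?thesis by (simp add: dist_real_def)
    qed
  qed (use r1 r2 in auto)
qed

lemma continuous_on_locally_lipschitz:
  fixes \<psi> :: "'a::metric_space \<times> real \<Rightarrow> real"
  assumes "locally_lipschitz_on (cyl T) \<psi>"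
  shows "continuous_on (cyl T) \<psi>"
  unfolding continuous_on_eq_continuous_within
proof
  fix z :: "'a \<times> real" assume z: "z \<in> cyl T"
  then obtain r L where r: "r > 0" "L-lipschitz_on (ball z r \<inter> cyl T) \<psi>"
    using assms unfolding locally_lipschitz_on_def by blast
  have "continuous (at z within ball z r \<inter> cyl T) \<psi>"
    using r z by (intro lipschitz_on_continuous_within[OF r(2)]) auto
  then show "continuous (at z within cyl T) \<psi>"
    using r(1) z open_Int[OF open_ball open_cyl, of z r T] 
      at_within_open[of z "ball z r \<inter> cyl T"]
    by (auto intro: continuous_at_imp_continuous_at_within)
qed

text \<open>Locally Lipschitz functions have difference quotients that are bounded near every point,
  which makes the upper limits in the slopes finite.\<close>

lemma eventually_quotient_le:
  fixes \<psi> :: "'a::metric_space \<times> real \<Rightarrow> real"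
  assumes "\<And>w w'. w \<in> ball z r \<Longrightarrow> w' \<in> ball z r \<Longrightarrow> \<bar>\<psi> w - \<psi> w'\<bar> \<le> L * dist w w'"
    and "(x, t) \<in> ball z r"
  shows "\<forall>\<^sub>F y in at x. \<bar>\<psi> (x, t) - \<psi> (y, t)\<bar> / dist x y \<le> L"
proof -
  have "open ((\<lambda>y. (y, t)) -` ball z r)"
    by (intro open_vimage) (auto intro!: continuous_intros)
  then have "\<forall>\<^sub>F y in at x. y \<in> (\<lambda>y. (y, t)) -` ball z r"
    using assms(2) by (intro eventually_at_in_open') auto
  then have "\<forall>\<^sub>F y in at x. (y, t) \<in> ball z r \<and> y \<noteq> x"
    by (auto simp: eventually_at_filter elim: eventually_mono)
  then show ?thesis
  proof (rule eventually_mono)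
    fix y assume "(y, t) \<in> ball z r \<and> y \<noteq> x"
    then show "\<bar>\<psi> (x, t) - \<psi> (y, t)\<bar> / dist x y \<le> L"
      using assms(1)[OF assms(2), of "(y, t)"]
      using \<open>(y, t) \<in> ball z r \<and> y \<noteq> x\<close> by (simp add: dist_Pair_Pair pos_divide_le_eq)
  qed
qed

lemma slope_nonneg: "0 \<le> slope \<psi> z"
  unfolding slope_def by (cases z) (auto intro!: real_Limsup_nonneg)

lemma slope_le:
  assumes "\<forall>\<^sub>F y in at x. \<bar>\<psi> (x, t) - \<psi> (y, t)\<bar> / dist x y \<le> L" "0 \<le> L"
  shows "slope \<psi> (x, t) \<le> L"
  using assms unfolding slope_def by (auto intro!: real_Limsup_le)

lemma eventually_le_slope:
  assumes "\<forall>\<^sub>F y in at x. \<bar>\<psi> (x, t) - \<psi> (y, t)\<bar> / dist x y \<le> L" "e > 0"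
  shows "\<forall>\<^sub>F y in nhds x. \<bar>\<psi> (x, t) - \<psi> (y, t)\<bar> \<le> (slope \<psi> (x, t) + e) * dist x y"
proof -
  have "\<forall>\<^sub>F y in at x. \<bar>\<psi> (x, t) - \<psi> (y, t)\<bar> / dist x y \<le> slope \<psi> (x, t) + e"
    unfolding slope_def using eventually_le_real_Limsup[OF _ assms] by auto
  then show ?thesis
    unfolding eventually_at_filter
  proof (rule eventually_mono)
    fix y
    assume "y \<noteq> x \<longrightarrow> y \<in> UNIV \<longrightarrow> \<bar>\<psi> (x, t) - \<psi> (y, t)\<bar> / dist x y \<le> slope \<psi> (x, t) + e"
    then show "\<bar>\<psi> (x, t) - \<psi> (y, t)\<bar> \<le> (slope \<psi> (x, t) + e) * dist x y"
      by (cases "y = x") (simp_all add: pos_divide_le_eq)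
  qed
qed

lemma frequently_ge_descending_slope:
  assumes "\<forall>\<^sub>F y in at x. \<bar>\<psi> (x, t) - \<psi> (y, t)\<bar> / dist x y \<le> L"
    and "0 < c" "c < descending_slope \<psi> (x, t)"
  shows "\<exists>\<^sub>F y in at x. c * dist x y \<le> \<psi> (x, t) - \<psi> (y, t)"
proof -
  let ?g = "\<lambda>y. max (\<psi> (x, t) - \<psi> (y, t)) 0 / dist x y"
  have "at x \<noteq> bot"
    using assms(2,3) by (auto simp: descending_slope_def bot_ereal_def)
  moreover have "\<forall>\<^sub>F y in at x. ?g y \<le> L"
    using assms(1)
  proof (rule eventually_mono)
    fix y assume "\<bar>\<psi> (x, t) - \<psi> (y, t)\<bar> / dist x y \<le> L"
    then show "?g y \<le> L"
      by (rule order_trans[rotated]) (auto intro!: divide_right_mono)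
  qed
  ultimately have "\<exists>\<^sub>F y in at x. descending_slope \<psi> (x, t) - (descending_slope \<psi> (x, t) - c) < ?g y"
    unfolding descending_slope_def prod.case
    by (intro frequently_ge_real_Limsup[where L=L])
      (use assms(3) in \<open>auto simp: descending_slope_def\<close>)
  moreover have "\<forall>\<^sub>F y in at x. y \<noteq> x" by (rule eventually_neq_at_within)
  ultimately have "\<exists>\<^sub>F y in at x. c < ?g y \<and> y \<noteq> x"
    by (auto dest: frequently_eventually_frequently)
  then show ?thesis
  proof (rule frequently_elim1)
    fix y assume *: "c < ?g y \<and> y \<noteq> x"
    then have "x \<noteq> y" by blast
    then have "0 < dist x y" by simp
    with * have "c * dist x y < max (\<psi> (x, t) - \<psi> (y, t)) 0"
      by (simp only: pos_less_divide_eq)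
    moreover have "0 \<le> c * dist x y" using assms(2) by simp
    ultimately show "c * dist x y \<le> \<psi> (x, t) - \<psi> (y, t)" by linarith
  qed
qed

lemma slope_le_usc_envelope:
  fixes \<psi> :: "'a::metric_space \<times> real \<Rightarrow> real"
  assumes "locally_lipschitz_on (cyl T) \<psi>" "z \<in> cyl T"
  shows "slope \<psi> z \<le> usc_envelope (slope \<psi>) z"
proof -
  obtain r L where r: "r > 0" "0 \<le> L"
    "\<And>w w'. w \<in> ball z r \<Longrightarrow> w' \<in> ball z r \<Longrightarrow> \<bar>\<psi> w - \<psi> w'\<bar> \<le> L * dist w w'"
    using locally_lipschitz_on_cylD[OF assms] by metis
  have "slope \<psi> w \<le> L" if "w \<in> ball z r" for w
  proof (cases w)
    case (Pair x t)
    show ?thesis unfolding Pair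
      using r that Pair by (intro slope_le[OF eventually_quotient_le]) auto
  qed
  moreover have "\<forall>\<^sub>F w in nhds z. w \<in> ball z r"
    using r(1) by (intro eventually_nhds_in_open) auto
  ultimately have "\<forall>\<^sub>F w in nhds z. slope \<psi> w \<le> L" by (auto elim: eventually_mono)
  then show ?thesis
    unfolding usc_envelope_def
  proof (rule le_real_Limsup[OF slope_nonneg])
    fix e :: real assume "e > 0"
    then show "\<exists>\<^sub>F w in nhds z. slope \<psi> z - e < slope \<psi> w"
      unfolding frequently_def by (auto dest: eventually_nhds_x_imp_x)
  qed
qed

lemma usc_envelope_slope_nonneg: "0 \<le> usc_envelope (slope \<psi>) z"
  unfolding usc_envelope_def by (rule real_Limsup_nonneg[OF slope_nonneg])

lemma usc_envelope_slope_le: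
  assumes "\<And>w. slope \<psi> w \<le> L"
  shows "usc_envelope (slope \<psi>) z \<le> L"
  unfolding usc_envelope_def
  using assms order_trans[OF slope_nonneg assms]
  by (intro real_Limsup_le[OF slope_nonneg]) auto

section \<open>The relaxed Hamiltonians\<close>

lemma hamil_eq: "hamil f x p = max p 0 - f x"
  by (simp add: hamil_def)

lemma hamil_lower_eq:
  assumes "0 \<le> r"
  shows "hamil_lower f r x p = max (p - r) 0 - f x"
proof -
  have "Inf (hamil f x ` {q. \<bar>q - p\<bar> \<le> r}) = hamil f x (p - r)"
    by (rule cInf_eq_minimum) (use assms in \<open>auto simp: hamil_eq\<close>)
  then show ?thesis by (simp add: hamil_lower_def hamil_eq)
qed

lemma hamil_upper_eq:
  assumes "0 \<le> r" "0 \<le> p"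
  shows "hamil_upper f r x p = p + r - f x"
proof -
  have "Sup (hamil f x ` {q. \<bar>q - p\<bar> \<le> r}) = hamil f x (p + r)"
  proof (rule cSup_eq_maximum)
    show "hamil f x (p + r) \<in> hamil f x ` {q. \<bar>q - p\<bar> \<le> r}"
      using assms by (intro imageI) auto
  qed (use assms in \<open>auto simp: hamil_eq\<close>)
  then show ?thesis using assms by (simp add: hamil_upper_def hamil_eq)
qed

section \<open>Monge solutions are slope-based solutions\<close>

lemma continuous_dt_on_cyl_DERIV:
  assumes "continuous_dt_on_cyl T \<psi>" "0 < t" "t < T"
  shows "((\<lambda>s. \<psi> (x, s)) has_real_derivative dt \<psi> (x, t)) (at t)"
  using assms unfolding continuous_dt_on_cyl_def dt_def
  by (auto simp: DERIV_deriv_iff_field_differentiable)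

lemma dt_eqI:
  "((\<lambda>s. \<psi> (x, s)) has_real_derivative D) (at t) \<Longrightarrow> dt \<psi> (x, t) = D"
  unfolding dt_def by (auto intro: DERIV_imp_deriv)

lemma dt_add:
  assumes "continuous_dt_on_cyl T \<psi>" "continuous_dt_on_cyl T \<phi>" "0 < t" "t < T"
  shows "dt (\<lambda>z. \<psi> z + \<phi> z) (x, t) = dt \<psi> (x, t) + dt \<phi> (x, t)"
  by (intro dt_eqI DERIV_add continuous_dt_on_cyl_DERIV) (use assms in auto)

lemma continuous_dt_on_cyl_minus:
  fixes \<psi> :: "'a::metric_space \<times> real \<Rightarrow> real"
  assumes "continuous_dt_on_cyl T (\<lambda>z. - \<psi> z)"
  shows "continuous_dt_on_cyl T \<psi>"
proof -
  have D: "((\<lambda>s. \<psi> (x, s)) has_real_derivative - dt (\<lambda>z. - \<psi> z) (x, t)) (at t)"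
    if "0 < t" "t < T" for x t
    using DERIV_minus[OF continuous_dt_on_cyl_DERIV[OF assms that]] by simp
  have "continuous_on (cyl T) (\<lambda>z. - dt (\<lambda>z. - \<psi> z) z)"
    using assms by (auto simp: continuous_dt_on_cyl_def intro: continuous_on_minus)
  moreover have "- dt (\<lambda>z. - \<psi> z) z = dt \<psi> z" if "z \<in> cyl T" for z
    using that D by (cases z) (auto simp: cyl_def dt_eqI[OF D])
  ultimately have "continuous_on (cyl T) (dt \<psi>)"
    by (simp cong: continuous_on_cong)
  moreover have "(\<lambda>s. \<psi> (x, s)) field_differentiable at t" if "t \<in> {0<..<T}" for x t
    unfolding field_differentiable_def by (rule exI, rule D) (use that in auto)
  ultimately show ?thesis
    unfolding continuous_dt_on_cyl_def by (intro conjI allI ballI)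
qed

text \<open>Continuity of the time derivative makes the first-order expansion in time uniform over the
  neighbouring points; this is what allows a space-time increment to be split into a spatial
  increment at a fixed time and a time increment at a varying point.\<close>

lemma time_increment:
  fixes \<psi> :: "'a::metric_space \<times> real \<Rightarrow> real"
  assumes "continuous_dt_on_cyl T \<psi>" "0 < t" "t < T" "e > 0"
  obtains r where "r > 0"
    "\<And>y \<delta>. dist x y < r \<Longrightarrow> 0 \<le> \<delta> \<Longrightarrow> \<delta> < r \<Longrightarrow>
       \<bar>\<psi> (y, t) - \<psi> (y, t - \<delta>) - dt \<psi> (x, t) * \<delta>\<bar> \<le> e * \<delta>"
proof -
  have "continuous_on (cyl T) (dt \<psi>)" "(x, t) \<in> cyl T"
    using assms by (auto simp: continuous_dt_on_cyl_def cylI)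
  then obtain r1 where r1: "r1 > 0"
    "\<And>w. w \<in> cyl T \<Longrightarrow> dist w (x, t) < r1 \<Longrightarrow> \<bar>dt \<psi> w - dt \<psi> (x, t)\<bar> < e"
    using \<open>e > 0\<close> unfolding continuous_on_iff dist_real_def by metis
  show ?thesis
  proof (rule that[of "min (r1/2) t"])
    show "0 < min (r1/2) t" using r1 assms by simp
    fix y \<delta> assume *: "dist x y < min (r1/2) t" "0 \<le> \<delta>" "\<delta> < min (r1/2) t"
    show "\<bar>\<psi> (y, t) - \<psi> (y, t - \<delta>) - dt \<psi> (x, t) * \<delta>\<bar> \<le> e * \<delta>"
    proof (cases "\<delta> = 0")
      case False
      have "\<exists>s. t - \<delta> < s \<and> s < t \<and>
          \<psi> (y, t) - \<psi> (y, t - \<delta>) = (t - (t - \<delta>)) * dt \<psi> (y, s)"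
        by (intro MVT2 continuous_dt_on_cyl_DERIV[OF assms(1)]) (use * False assms in auto)
      then obtain s where s: "t - \<delta> < s" "s < t"
        "\<psi> (y, t) - \<psi> (y, t - \<delta>) = \<delta> * dt \<psi> (y, s)" by auto
      have "dist (y, s) (x, t) \<le> dist x y + \<bar>t - s\<bar>"
        using sqrt_sum_squares_le_sum_abs[of "dist y x" "dist s t"]
        by (simp add: dist_Pair_Pair dist_commute dist_real_def)
      then have "dist (y, s) (x, t) < r1" using * s by auto
      moreover have "(y, s) \<in> cyl T" using s * assms by (intro cylI) auto
      ultimately have "\<bar>dt \<psi> (y, s) - dt \<psi> (x, t)\<bar> \<le> e" using r1(2) by force
      then have "\<bar>dt \<psi> (y, s) - dt \<psi> (x, t)\<bar> * \<delta> \<le> e * \<delta>" using * by (intro mult_right_mono)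
      moreover have "\<psi> (y, t) - \<psi> (y, t - \<delta>) - dt \<psi> (x, t) * \<delta>
          = (dt \<psi> (y, s) - dt \<psi> (x, t)) * \<delta>" using s(3) by (simp add: algebra_simps)
      ultimately show ?thesis using * by (simp add: abs_mult)
    qed simp
  qed
qed

lemma has_local_max_at_cylE:
  fixes g :: "'a::metric_space \<times> real \<Rightarrow> real"
  assumes "has_local_max_at (cyl T) g (x, t)" "0 < t" "t < T"
  obtains r where "r > 0"
    "\<And>y s. dist x y < r \<Longrightarrow> \<bar>t - s\<bar> < r \<Longrightarrow> g (y, s) \<le> g (x, t)"
proof -
  have z: "(x, t) \<in> cyl T" using assms by (simp add: cylI)
  then have "\<forall>\<^sub>F w in at (x, t). g w \<le> g (x, t)"
    using assms(1) at_within_open[OF z open_cyl] by (simp add: has_local_max_at_def)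
  then obtain r where r: "r > 0" "\<And>w. w \<noteq> (x, t) \<Longrightarrow> dist w (x, t) < r \<Longrightarrow> g w \<le> g (x, t)"
    by (auto simp: eventually_at)
  show ?thesis
  proof (rule that[of "r/2"])
    fix y s assume *: "dist x y < r/2" "\<bar>t - s\<bar> < r/2"
    have "dist (y, s) (x, t) \<le> dist x y + \<bar>t - s\<bar>"
      using sqrt_sum_squares_le_sum_abs[of "dist y x" "dist s t"]
      by (simp add: dist_Pair_Pair dist_commute dist_real_def)
    then show "g (y, s) \<le> g (x, t)" using * r(2)[of "(y, s)"] by (cases "(y, s) = (x, t)") auto
  qed (use r in auto)
qed

lemma eventually_nhds_dist: "r > 0 \<Longrightarrow> \<forall>\<^sub>F y in nhds x. dist x y < (r::real)"
  by (simp add: eventually_nhds_metric dist_commute) blast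

lemma eventually_le_slope_of_locally_lipschitz:
  fixes \<psi> :: "'a::metric_space \<times> real \<Rightarrow> real"
  assumes "locally_lipschitz_on (cyl T) \<psi>" "0 < t" "t < T" "e > 0"
  shows "\<forall>\<^sub>F y in nhds x. \<bar>\<psi> (x, t) - \<psi> (y, t)\<bar> \<le> (slope \<psi> (x, t) + e) * dist x y"
proof -
  obtain r L where r: "r > 0"
    "\<And>w w'. w \<in> ball (x, t) r \<Longrightarrow> w' \<in> ball (x, t) r \<Longrightarrow> \<bar>\<psi> w - \<psi> w'\<bar> \<le> L * dist w w'"
    using locally_lipschitz_on_cylD[OF assms(1) cylI[OF assms(2,3)]] by metis
  have "\<forall>\<^sub>F y in at x. \<bar>\<psi> (x, t) - \<psi> (y, t)\<bar> / dist x y \<le> L"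
    by (rule eventually_quotient_le[where z="(x, t)" and r=r]) (use r in auto)
  then show ?thesis using assms(4) by (rule eventually_le_slope)
qed

lemma frequently_ge_descending_slope_of_locally_lipschitz:
  fixes \<psi> :: "'a::metric_space \<times> real \<Rightarrow> real"
  assumes "locally_lipschitz_on (cyl T) \<psi>" "0 < t" "t < T" "0 < c" "c < descending_slope \<psi> (x, t)"
  shows "\<exists>\<^sub>F y in at x. c * dist x y \<le> \<psi> (x, t) - \<psi> (y, t)"
proof -
  obtain r L where r: "r > 0"
    "\<And>w w'. w \<in> ball (x, t) r \<Longrightarrow> w' \<in> ball (x, t) r \<Longrightarrow> \<bar>\<psi> w - \<psi> w'\<bar> \<le> L * dist w w'"
    using locally_lipschitz_on_cylD[OF assms(1) cylI[OF assms(2,3)]] by metis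
  have "\<forall>\<^sub>F y in at x. \<bar>\<psi> (x, t) - \<psi> (y, t)\<bar> / dist x y \<le> L"
    by (rule eventually_quotient_le[where z="(x, t)" and r=r]) (use r in auto)
  then show ?thesis using assms(4,5) by (rule frequently_ge_descending_slope)
qed

text \<open>Let \<open>p\<close> and \<open>q\<close> be the slopes of \<open>\<psi>1\<close> and \<open>\<psi>2\<close>. Standing still for time \<open>\<delta>\<close> gives
  \<open>\<partial>\<^sub>t\<psi> \<le> f\<close>. If \<open>p > q\<close>, one takes points \<open>y\<close> at which \<open>\<psi>1\<close> drops at a rate close to its descending
  slope \<open>p\<close> and moves there at unit speed, that is, with \<open>\<delta> = dist x y\<close>; the part \<open>\<psi>2\<close> can give
  back at most the rate \<open>q\<close>, whence \<open>\<partial>\<^sub>t\<psi> + p - q \<le> f\<close>.\<close>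

lemma subsolution_inequality_of_Dminus_le:
  fixes u :: "'a::metric_space \<times> real \<Rightarrow> real"
  assumes D: "Dminus u x t \<le> ereal (f x)" and t: "0 < t" "t < T"
    and test: "sub_test T \<psi>1 \<psi>2"
    and max: "has_local_max_at (cyl T) (\<lambda>z. u z - (\<psi>1 z + \<psi>2 z)) (x, t)"
  shows "dt (\<lambda>z. \<psi>1 z + \<psi>2 z) (x, t) +
    hamil_lower f (usc_envelope (slope \<psi>2) (x, t)) x (slope \<psi>1 (x, t)) \<le> 0"
proof -
  let ?p = "slope \<psi>1 (x, t)" and ?q = "slope \<psi>2 (x, t)"
  let ?m = "dt \<psi>1 (x, t) + dt \<psi>2 (x, t)"
  have test': "locally_lipschitz_on (cyl T) \<psi>1" "locally_lipschitz_on (cyl T) \<psi>2"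
    "slope \<psi>1 (x, t) = descending_slope \<psi>1 (x, t)"
    and cdt: "continuous_dt_on_cyl T \<psi>1" "continuous_dt_on_cyl T \<psi>2"
    using test cylI[OF t, of x] by (simp_all add: sub_test_def)
  have z: "(x, t) \<in> cyl T" using t by (simp add: cylI)
  have key: "\<exists>r>0. \<forall>y \<delta>. dist x y \<le> \<delta> \<and> 0 < \<delta> \<and> \<delta> < r \<longrightarrow>
      \<psi>1 (x, t) + \<psi>2 (x, t) - (\<psi>1 (y, t) + \<psi>2 (y, t)) \<le> (f x - ?m + 3 * e) * \<delta>"
    if "e > 0" for e
  proof -
    have "\<forall>\<^sub>F \<delta> in at_right 0. \<forall>y\<in>cball x \<delta>. u (x, t) - u (y, t - \<delta>) \<le> (f x + e) * \<delta>"
      using D \<open>e > 0\<close> by (simp only: Dminus_le_iff)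
    then obtain r0 where r0: "r0 > 0"
      "\<forall>\<delta>>0. \<delta> < r0 \<longrightarrow> (\<forall>y\<in>cball x \<delta>. u (x, t) - u (y, t - \<delta>) \<le> (f x + e) * \<delta>)"
      unfolding eventually_at_right_field by blast
    obtain r1 where r1: "r1 > 0" "\<And>y s. dist x y < r1 \<Longrightarrow> \<bar>t - s\<bar> < r1 \<Longrightarrow>
        u (y, s) - (\<psi>1 (y, s) + \<psi>2 (y, s)) \<le> u (x, t) - (\<psi>1 (x, t) + \<psi>2 (x, t))"
      using has_local_max_at_cylE[OF max t] by metis
    obtain r2 where r2: "r2 > 0" "\<And>y \<delta>. dist x y < r2 \<Longrightarrow> 0 \<le> \<delta> \<Longrightarrow> \<delta> < r2 \<Longrightarrow>
       \<bar>\<psi>1 (y, t) - \<psi>1 (y, t - \<delta>) - dt \<psi>1 (x, t) * \<delta>\<bar> \<le> e * \<delta>"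
      using time_increment[OF cdt(1) t \<open>e > 0\<close>, of x] by metis
    obtain r3 where r3: "r3 > 0" "\<And>y \<delta>. dist x y < r3 \<Longrightarrow> 0 \<le> \<delta> \<Longrightarrow> \<delta> < r3 \<Longrightarrow>
       \<bar>\<psi>2 (y, t) - \<psi>2 (y, t - \<delta>) - dt \<psi>2 (x, t) * \<delta>\<bar> \<le> e * \<delta>"
      using time_increment[OF cdt(2) t \<open>e > 0\<close>, of x] by metis
    show ?thesis
    proof (intro exI[of _ "min (min r0 r1) (min r2 r3)"] conjI allI impI)
      fix y \<delta> assume *: "dist x y \<le> \<delta> \<and> 0 < \<delta> \<and> \<delta> < min (min r0 r1) (min r2 r3)"
      have "u (x, t) - u (y, t - \<delta>) \<le> (f x + e) * \<delta>" using * r0(2) by simp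
      moreover have "u (y, t - \<delta>) - (\<psi>1 (y, t - \<delta>) + \<psi>2 (y, t - \<delta>))
          \<le> u (x, t) - (\<psi>1 (x, t) + \<psi>2 (x, t))" using * by (intro r1(2)) auto
      moreover have "\<bar>\<psi>1 (y, t) - \<psi>1 (y, t - \<delta>) - dt \<psi>1 (x, t) * \<delta>\<bar> \<le> e * \<delta>" using * by (intro r2(2)) auto
      moreover have "\<bar>\<psi>2 (y, t) - \<psi>2 (y, t - \<delta>) - dt \<psi>2 (x, t) * \<delta>\<bar> \<le> e * \<delta>" using * by (intro r3(2)) auto
      ultimately show "\<psi>1 (x, t) + \<psi>2 (x, t) - (\<psi>1 (y, t) + \<psi>2 (y, t)) \<le> (f x - ?m + 3 * e) * \<delta>"
        by (simp add: algebra_simps abs_le_iff)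
    qed (use r0 r1 r2 r3 in auto)
  qed
  have m_le: "?m \<le> f x"
  proof (rule field_le_epsilon)
    fix e :: real assume "0 < e"
    then have "0 < e/3" by simp
    from key[OF this] obtain r where r: "r > 0" "\<forall>y \<delta>. dist x y \<le> \<delta> \<and> 0 < \<delta> \<and> \<delta> < r \<longrightarrow>
      \<psi>1 (x, t) + \<psi>2 (x, t) - (\<psi>1 (y, t) + \<psi>2 (y, t)) \<le> (f x - ?m + 3 * (e/3)) * \<delta>"
      by blast
    have "0 \<le> (f x - ?m + e) * (r/2)" using r(2)[rule_format, of x "r/2"] r(1) by simp
    then show "?m \<le> f x + e" using r(1) by (simp add: zero_le_mult_iff)
  qed
  have "?p - ?q + ?m \<le> f x" if "?q < ?p"
  proof -
    have p: "?p > 0" using that slope_nonneg[of \<psi>2 "(x, t)"] by linarith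
    have "c \<le> f x - ?m + ?q" if c: "0 < c" "c < ?p" for c
    proof (rule field_le_epsilon)
      fix e :: real assume "0 < e"
      then have "0 < e/4" by simp
    from key[OF this] obtain r where r: "r > 0" "\<forall>y \<delta>. dist x y \<le> \<delta> \<and> 0 < \<delta> \<and> \<delta> < r \<longrightarrow>
        \<psi>1 (x, t) + \<psi>2 (x, t) - (\<psi>1 (y, t) + \<psi>2 (y, t)) \<le> (f x - ?m + 3 * (e/4)) * \<delta>"
        by blast
      have "\<forall>\<^sub>F y in nhds x. \<bar>\<psi>2 (x, t) - \<psi>2 (y, t)\<bar> \<le> (?q + e/4) * dist x y"
        using test' t \<open>0 < e\<close> by (intro eventually_le_slope_of_locally_lipschitz) auto
      then have ev: "\<forall>\<^sub>F y in at x. \<bar>\<psi>2 (x, t) - \<psi>2 (y, t)\<bar> \<le> (?q + e/4) * dist x y \<and> dist x y < r \<and> y \<noteq> x"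
        using eventually_nhds_dist[OF r(1)] unfolding eventually_at_filter
        by eventually_elim auto
      have fr: "\<exists>\<^sub>F y in at x. c * dist x y \<le> \<psi>1 (x, t) - \<psi>1 (y, t)"
        using test' t c by (intro frequently_ge_descending_slope_of_locally_lipschitz) auto
      obtain y where y: "c * dist x y \<le> \<psi>1 (x, t) - \<psi>1 (y, t)"
          "\<bar>\<psi>2 (x, t) - \<psi>2 (y, t)\<bar> \<le> (?q + e/4) * dist x y" "dist x y < r" "y \<noteq> x"
        using frequently_ex[OF frequently_eventually_frequently[OF fr ev]] by blast
      have "\<psi>1 (x, t) + \<psi>2 (x, t) - (\<psi>1 (y, t) + \<psi>2 (y, t)) \<le> (f x - ?m + 3 * (e/4)) * dist x y"
        using y by (intro r(2)[rule_format]) auto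
      then have "(?m - f x - ?q + c) * dist x y \<le> e * dist x y"
        using y(1,2) by (simp add: algebra_simps abs_le_iff)
      then have "?m - f x - ?q + c \<le> e" using y(4) by simp
      then show "c \<le> f x - ?m + ?q + e" by simp
    qed
    then have "?p \<le> f x - ?m + ?q" by (rule dense_le_bounded[OF p])
    then show ?thesis by simp
  qed
  moreover have "?q \<le> usc_envelope (slope \<psi>2) (x, t)"
    using slope_le_usc_envelope[OF test'(2) z] .
  moreover have "dt (\<lambda>z. \<psi>1 z + \<psi>2 z) (x, t) = ?m"
    using cdt t by (rule dt_add)
  ultimately have "dt (\<lambda>z. \<psi>1 z + \<psi>2 z) (x, t)
      + (max (?p - usc_envelope (slope \<psi>2) (x, t)) 0 - f x) \<le> 0"
    using m_le by (cases "?q < ?p") (simp_all add: max_def)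
  then show ?thesis by (simp add: hamil_lower_eq usc_envelope_slope_nonneg)
qed

text \<open>Along steps that nearly realise the backward derivative, \<open>\<psi>\<close> decreases at least as much as \<open>u\<close>;
  since such a step covers a distance of at most \<open>\<delta>\<close> in time \<open>\<delta>\<close>, the decrease of \<open>\<psi>\<close> is at most
  \<open>\<delta>\<close> times \<open>\<partial>\<^sub>t\<psi>\<close> plus the two slopes.\<close>

lemma supersolution_inequality_of_le_Dminus:
  fixes u :: "'a::metric_space \<times> real \<Rightarrow> real"
  assumes D: "ereal (f x) \<le> Dminus u x t" and t: "0 < t" "t < T"
    and test: "super_test T \<psi>1 \<psi>2"
    and min: "has_local_min_at (cyl T) (\<lambda>z. u z - (\<psi>1 z + \<psi>2 z)) (x, t)"
  shows "0 \<le> dt (\<lambda>z. \<psi>1 z + \<psi>2 z) (x, t) +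
    hamil_upper f (usc_envelope (slope \<psi>2) (x, t)) x (slope \<psi>1 (x, t))"
proof -
  have lip: "locally_lipschitz_on (cyl T) \<psi>1" "locally_lipschitz_on (cyl T) \<psi>2"
    and cdt: "continuous_dt_on_cyl T \<psi>1" "continuous_dt_on_cyl T \<psi>2"
    using test unfolding super_test_def sub_test_def
    by (auto simp: locally_lipschitz_on_def intro: continuous_dt_on_cyl_minus)
  let ?p = "slope \<psi>1 (x, t)" and ?q = "slope \<psi>2 (x, t)"
  let ?m = "dt \<psi>1 (x, t) + dt \<psi>2 (x, t)"
  have z: "(x, t) \<in> cyl T" using t by (simp add: cylI)
  have max: "has_local_max_at (cyl T) (\<lambda>z. (\<psi>1 z + \<psi>2 z) - u z) (x, t)"
    using min unfolding has_local_max_at_def has_local_min_at_def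
    by (auto elim!: eventually_mono)
  have "f x \<le> ?m + ?p + ?q"
  proof (rule field_le_epsilon)
    fix e :: real assume "0 < e"
    define d where "d = e/5"
    have d: "d > 0" using \<open>0 < e\<close> by (simp add: d_def)
    obtain r1 where r1: "r1 > 0" "\<And>y s. dist x y < r1 \<Longrightarrow> \<bar>t - s\<bar> < r1 \<Longrightarrow>
        (\<psi>1 (y, s) + \<psi>2 (y, s)) - u (y, s) \<le> (\<psi>1 (x, t) + \<psi>2 (x, t)) - u (x, t)"
      using has_local_max_at_cylE[OF max t] by metis
    obtain r2 where r2: "r2 > 0" "\<And>y \<delta>. dist x y < r2 \<Longrightarrow> 0 \<le> \<delta> \<Longrightarrow> \<delta> < r2 \<Longrightarrow>
       \<bar>\<psi>1 (y, t) - \<psi>1 (y, t - \<delta>) - dt \<psi>1 (x, t) * \<delta>\<bar> \<le> d * \<delta>"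
      using time_increment[OF cdt(1) t d, of x] by metis
    obtain r3 where r3: "r3 > 0" "\<And>y \<delta>. dist x y < r3 \<Longrightarrow> 0 \<le> \<delta> \<Longrightarrow> \<delta> < r3 \<Longrightarrow>
       \<bar>\<psi>2 (y, t) - \<psi>2 (y, t - \<delta>) - dt \<psi>2 (x, t) * \<delta>\<bar> \<le> d * \<delta>"
      using time_increment[OF cdt(2) t d, of x] by metis
    have "\<forall>\<^sub>F y in nhds x. \<bar>\<psi>1 (x, t) - \<psi>1 (y, t)\<bar> \<le> (?p + d) * dist x y"
      and "\<forall>\<^sub>F y in nhds x. \<bar>\<psi>2 (x, t) - \<psi>2 (y, t)\<bar> \<le> (?q + d) * dist x y"
      using lip t d by (auto intro!: eventually_le_slope_of_locally_lipschitz)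
    then have "\<forall>\<^sub>F y in nhds x. \<bar>\<psi>1 (x, t) - \<psi>1 (y, t)\<bar> \<le> (?p + d) * dist x y
      \<and> \<bar>\<psi>2 (x, t) - \<psi>2 (y, t)\<bar> \<le> (?q + d) * dist x y" by eventually_elim auto
    then obtain r4 where r4: "r4 > 0" "\<And>y. dist x y < r4 \<Longrightarrow>
      \<bar>\<psi>1 (x, t) - \<psi>1 (y, t)\<bar> \<le> (?p + d) * dist x y
      \<and> \<bar>\<psi>2 (x, t) - \<psi>2 (y, t)\<bar> \<le> (?q + d) * dist x y"
      unfolding eventually_nhds_metric by (metis dist_commute)
    let ?r = "min (min r1 r2) (min r3 r4)"
    have "\<exists>\<^sub>F \<delta> in at_right 0. \<exists>y\<in>cball x \<delta>. (f x - d) * \<delta> < u (x, t) - u (y, t - \<delta>)"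
      using D d unfolding le_Dminus_iff by blast
    moreover have "\<forall>\<^sub>F \<delta> in at_right 0. 0 < \<delta> \<and> \<delta> < ?r"
      unfolding eventually_at_right_field using r1(1) r2(1) r3(1) r4(1)
      by (intro exI[of _ ?r]) auto
    ultimately have "\<exists>\<^sub>F \<delta> in at_right 0.
        (\<exists>y\<in>cball x \<delta>. (f x - d) * \<delta> < u (x, t) - u (y, t - \<delta>)) \<and> 0 < \<delta> \<and> \<delta> < ?r"
      by (rule frequently_eventually_frequently)
    then obtain \<delta> y where \<delta>: "0 < \<delta>" "\<delta> < ?r" "dist x y \<le> \<delta>"
      "(f x - d) * \<delta> < u (x, t) - u (y, t - \<delta>)"
      by (auto dest!: frequently_ex)
    have "(\<psi>1 (y, t - \<delta>) + \<psi>2 (y, t - \<delta>)) - u (y, t - \<delta>)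
        \<le> (\<psi>1 (x, t) + \<psi>2 (x, t)) - u (x, t)" using \<delta> by (intro r1(2)) auto
    moreover have "\<bar>\<psi>1 (y, t) - \<psi>1 (y, t - \<delta>) - dt \<psi>1 (x, t) * \<delta>\<bar> \<le> d * \<delta>" using \<delta> by (intro r2(2)) auto
    moreover have "\<bar>\<psi>2 (y, t) - \<psi>2 (y, t - \<delta>) - dt \<psi>2 (x, t) * \<delta>\<bar> \<le> d * \<delta>" using \<delta> by (intro r3(2)) auto
    moreover have "\<bar>\<psi>1 (x, t) - \<psi>1 (y, t)\<bar> \<le> (?p + d) * \<delta>" "\<bar>\<psi>2 (x, t) - \<psi>2 (y, t)\<bar> \<le> (?q + d) * \<delta>"
    proof -
      have "(?p + d) * dist x y \<le> (?p + d) * \<delta>" "(?q + d) * dist x y \<le> (?q + d) * \<delta>"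
        using \<delta>(3) d slope_nonneg[of \<psi>1 "(x, t)"] slope_nonneg[of \<psi>2 "(x, t)"]
        by (auto intro!: mult_left_mono)
      moreover have "\<bar>\<psi>1 (x, t) - \<psi>1 (y, t)\<bar> \<le> (?p + d) * dist x y
          \<and> \<bar>\<psi>2 (x, t) - \<psi>2 (y, t)\<bar> \<le> (?q + d) * dist x y"
        using \<delta> by (intro r4(2)) auto
      ultimately show "\<bar>\<psi>1 (x, t) - \<psi>1 (y, t)\<bar> \<le> (?p + d) * \<delta>"
        "\<bar>\<psi>2 (x, t) - \<psi>2 (y, t)\<bar> \<le> (?q + d) * \<delta>" by auto
    qed
    ultimately have "(f x) * \<delta> \<le> (?m + ?p + ?q + 5 * d) * \<delta>"
      using \<delta>(4) by (simp add: algebra_simps abs_le_iff)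
    then show "f x \<le> ?m + ?p + ?q + e" using \<delta>(1) by (simp add: d_def)
  qed
  moreover have "?q \<le> usc_envelope (slope \<psi>2) (x, t)"
    using slope_le_usc_envelope[OF lip(2) z] .
  moreover have "dt (\<lambda>z. \<psi>1 z + \<psi>2 z) (x, t) = ?m"
    using cdt t by (rule dt_add)
  ultimately show ?thesis
    by (simp add: hamil_upper_eq usc_envelope_slope_nonneg slope_nonneg)
qed

lemma locally_bounded_on_continuous:
  fixes u :: "'a::metric_space \<Rightarrow> real"
  assumes "continuous_on S u"
  shows "locally_bounded_on S u"
  unfolding locally_bounded_on_def
proof
  fix z assume "z \<in> S"
  with assms obtain r where r: "r > 0" "\<And>w. w \<in> S \<Longrightarrow> dist w z < r \<Longrightarrow> dist (u w) (u z) < 1"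
    unfolding continuous_on_iff by (metis zero_less_one)
  have "u ` (ball z r \<inter> S) \<subseteq> cball (u z) 1"
    using r(2) by (force simp: dist_commute)
  then have "bounded (u ` (ball z r \<inter> S))" by (rule bounded_subset[OF bounded_cball])
  with r show "\<exists>r>0. bounded (u ` (ball z r \<inter> S))" by blast
qed

lemma semicontinuous_on_continuous:
  fixes u :: "'a::metric_space \<Rightarrow> real"
  assumes "continuous_on S u"
  shows "usc_on S u" "lsc_on S u"
proof -
  have "((\<lambda>w. ereal (u w)) \<longlongrightarrow> ereal (u z)) (at z within S)" if "z \<in> S" for z
    using assms that unfolding continuous_on_def by (auto intro: tendsto_intros)
  then have *: "at z within S = bot \<or> Limsup (at z within S) (\<lambda>w. ereal (u w)) = ereal (u z) \<and>
     Liminf (at z within S) (\<lambda>w. ereal (u w)) = ereal (u z)" if "z \<in> S" for z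
    using that by (auto intro: lim_imp_Limsup lim_imp_Liminf)
  show "usc_on S u" unfolding usc_on_def using * by (metis Limsup_bot bot_least order_refl)
  show "lsc_on S u" unfolding lsc_on_def using * by (metis Liminf_bot top_greatest order_refl)
qed

proposition slope_solution_of_Dminus_eq:
  fixes u :: "'a::metric_space \<times> real \<Rightarrow> real"
  assumes "locally_lipschitz_on (cyl T) u"
    and "\<And>x t. 0 < t \<Longrightarrow> t < T \<Longrightarrow> Dminus u x t = ereal (f x)"
  shows "slope_solution T f u"
proof -
  have c: "continuous_on (cyl T) u"
    using assms(1) by (rule continuous_on_locally_lipschitz)
  have "slope_subsolution T f u"
    unfolding slope_subsolution_def
    using locally_bounded_on_continuous[OF c] semicontinuous_on_continuous[OF c] assms(2)
    by (auto intro!: subsolution_inequality_of_Dminus_le)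
  moreover have "slope_supersolution T f u"
    unfolding slope_supersolution_def
    using locally_bounded_on_continuous[OF c] semicontinuous_on_continuous[OF c] assms(2)
    by (auto intro!: supersolution_inequality_of_le_Dminus)
  ultimately show ?thesis using c by (simp add: slope_solution_def)
qed

section \<open>Maximal elements of closed preorders\<close>

text \<open>A common form of the variational principles of Ekeland and of Brezis and Browder: choose
  greedily a sequence that makes \<open>\<tau>\<close> almost as small as the relation permits. Its spatial components
  form a Cauchy sequence because \<open>\<tau>\<close> controls the distance, its times have a convergent
  subsequence, and closedness puts the limit below every member of the sequence. Only the spatial
  distance is controlled by \<open>\<tau>\<close>; compactness in time replaces the missing control there.\<close>

lemma closed_preorder_maximal_element:
  fixes R :: "'a::complete_space \<times> real \<Rightarrow> 'a \<times> real \<Rightarrow> bool" and \<tau> :: "'a \<times> real \<Rightarrow> real"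
  assumes refl: "\<And>z. z \<in> D \<Longrightarrow> R z z"
    and trans: "\<And>z w v. R z w \<Longrightarrow> R w v \<Longrightarrow> R z v"
    and inD: "\<And>z w. z \<in> D \<Longrightarrow> R z w \<Longrightarrow> w \<in> D"
    and dist: "\<And>z w. z \<in> D \<Longrightarrow> R z w \<Longrightarrow> dist (fst z) (fst w) \<le> \<tau> z - \<tau> w"
    and closed: "\<And>z. z \<in> D \<Longrightarrow> closed {w. R z w}"
    and bdd: "bdd_below (\<tau> ` D)" and bounded: "bounded (snd ` D)"
    and z0: "z0 \<in> D"
  obtains z where "R z0 z" "\<And>w. R z w \<Longrightarrow> \<tau> w = \<tau> z"
proof -
  define m where "m z = Inf (\<tau> ` {w. R z w})" for z
  have bdd': "bdd_below (\<tau> ` {w. R z w})" if "z \<in> D" for z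
    using bdd by (rule bdd_below_mono) (use inD[OF that] in blast)
  have step: "\<exists>w. R z w \<and> \<tau> w < m z + e" if "z \<in> D" "e > 0" for z e
  proof -
    have "Inf (\<tau> ` {w. R z w}) < m z + e" using that by (simp add: m_def)
    moreover have "\<tau> ` {w. R z w} \<noteq> {}" using refl[OF that(1)] by blast
    ultimately show ?thesis using bdd'[OF that(1)] by (auto simp: cInf_less_iff)
  qed
  have "\<exists>Z. Z 0 = z0 \<and> (\<forall>n. (Z n \<in> D) \<and> R (Z n) (Z (Suc n)) \<and>
      \<tau> (Z (Suc n)) < m (Z n) + 1 / real (Suc n))"
  proof -
    have "\<exists>Z. \<forall>n. (Z n \<in> D \<and> (n = 0 \<longrightarrow> Z n = z0)) \<and> (R (Z n) (Z (Suc n)) \<and>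
      \<tau> (Z (Suc n)) < m (Z n) + 1 / real (Suc n))"
    proof (rule dependent_nat_choice)
      show "\<exists>z. z \<in> D \<and> (0 = (0::nat) \<longrightarrow> z = z0)" using z0 by blast
      fix z and n :: nat assume "z \<in> D \<and> (n = 0 \<longrightarrow> z = z0)"
      then have z: "z \<in> D" by simp
      then obtain w where "R z w" "\<tau> w < m z + 1 / real (Suc n)"
        using step[of z "1 / real (Suc n)"] by auto
      then show "\<exists>w. (w \<in> D \<and> (Suc n = 0 \<longrightarrow> w = z0)) \<and> R z w \<and> \<tau> w < m z + 1 / real (Suc n)"
        using inD[OF z] by blast
    qed
    then show ?thesis by blast
  qed
  then obtain Z where Z: "Z 0 = z0" "\<And>n. Z n \<in> D" "\<And>n. R (Z n) (Z (Suc n))"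
    "\<And>n. \<tau> (Z (Suc n)) < m (Z n) + 1 / real (Suc n)" by blast
  have mono: "R (Z n) (Z k)" if "n \<le> k" for n k
    using that by (induction rule: dec_induct) (use refl Z trans in blast)+
  have low: "\<tau> (Z (Suc n)) - 1 / real (Suc n) \<le> \<tau> w" if "R (Z n) w" for n w
  proof -
    have "m (Z n) \<le> \<tau> w" unfolding m_def
      using bdd'[OF Z(2)] that by (intro cInf_lower) auto
    then show ?thesis using Z(4)[of n] by linarith
  qed
  have near: "dist (fst (Z (Suc n))) (fst w) \<le> 1 / real (Suc n)" if "R (Z (Suc n)) w" for n w
    using dist[OF Z(2) that] low[of n w] trans[OF Z(3) that] by linarith
  have "Cauchy (\<lambda>n. fst (Z (Suc n)))"
    unfolding Cauchy_altdef
  proof (intro allI impI)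
    fix e :: real assume "e > 0"
    then obtain N where N: "inverse (real (Suc N)) < e" using reals_Archimedean by blast
    show "\<exists>M. \<forall>k\<ge>M. \<forall>n>k. dist (fst (Z (Suc k))) (fst (Z (Suc n))) < e"
    proof (intro exI[of _ N] allI impI)
      fix k n assume "N \<le> k" "k < n"
      then have "dist (fst (Z (Suc k))) (fst (Z (Suc n))) \<le> 1 / real (Suc k)"
        by (intro near mono) auto
      also have "\<dots> \<le> inverse (real (Suc N))" using \<open>N \<le> k\<close> by (simp add: field_simps)
      finally show "dist (fst (Z (Suc k))) (fst (Z (Suc n))) < e" using N by simp
    qed
  qed
  then obtain x where x: "(\<lambda>n. fst (Z (Suc n))) \<longlonglongrightarrow> x"
    using Cauchy_convergent convergent_def by blast
  have "bounded (range (\<lambda>n. snd (Z (Suc n))))"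
    using bounded by (rule bounded_subset) (use Z(2) in auto)
  then obtain s r where r: "strict_mono r" "((\<lambda>n. snd (Z (Suc n))) \<circ> r) \<longlonglongrightarrow> s"
    using bounded_imp_convergent_subsequence by blast
  have lim: "(\<lambda>n. Z (Suc (r n))) \<longlonglongrightarrow> (x, s)"
  proof -
    have "(\<lambda>n. (fst (Z (Suc (r n))), snd (Z (Suc (r n))))) \<longlonglongrightarrow> (x, s)"
      using LIMSEQ_subseq_LIMSEQ[OF x r(1)] r(2) by (intro tendsto_Pair) (simp_all add: o_def)
    then show ?thesis by simp
  qed
  have reach: "R (Z n) (x, s)" for n
  proof -
    have "(x, s) \<in> {w. R (Z n) w}"
    proof (rule Lim_in_closed_set[OF closed[OF Z(2)] _ _ lim])
      have "\<forall>\<^sub>F k in sequentially. n \<le> k" by (rule eventually_ge_at_top)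
      then show "\<forall>\<^sub>F k in sequentially. Z (Suc (r k)) \<in> {w. R (Z n) w}"
      proof (rule eventually_mono)
        fix k assume "n \<le> k"
        also have "k \<le> Suc (r k)" using seq_suble[OF r(1), of k] by simp
        finally show "Z (Suc (r k)) \<in> {w. R (Z n) w}" by (simp add: mono)
      qed
    qed simp
    then show ?thesis by simp
  qed
  show ?thesis
  proof (rule that[of "(x, s)"])
    show "R z0 (x, s)" using reach[of 0] Z(1) by simp
    fix w assume w: "R (x, s) w"
    have D: "(x, s) \<in> D" using inD[OF z0 \<open>R z0 (x, s)\<close>] .
    have "\<tau> w \<le> \<tau> (x, s)" using dist[OF D w] zero_le_dist by (smt (verit))
    moreover have "\<tau> (x, s) \<le> \<tau> w"
    proof (rule field_le_epsilon)
      fix e :: real assume "0 < e"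
      then obtain n where n: "inverse (real (Suc n)) < e" using reals_Archimedean by blast
      have "\<tau> (Z (Suc n)) - 1 / real (Suc n) \<le> \<tau> w" using trans[OF reach w] by (rule low)
      moreover have "\<tau> (x, s) \<le> \<tau> (Z (Suc n))"
        using dist[OF Z(2) reach[of "Suc n"]] zero_le_dist by (smt (verit))
      ultimately show "\<tau> (x, s) \<le> \<tau> w + e" using n by (simp add: inverse_eq_divide)
    qed
    ultimately show "\<tau> w = \<tau> (x, s)" by simp
  qed
qed

text \<open>Closed balls of \<open>'a\<close> need not be compact, so maxima are only attained after a perturbation. The
  perturbation acts in the spatial variable alone: a term like \<open>\<bar>s - t\<bar>\<close> would not have a continuous
  time derivative and could not be part of a test function.\<close>

lemma spatial_ekeland:
  fixes g :: "'a::complete_space \<times> real \<Rightarrow> real"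
  assumes D: "closed D" "bounded (snd ` D)" and g: "continuous_on D g" "bdd_above (g ` D)"
    and z0: "z0 \<in> D" and e: "e > 0"
  obtains x t where "(x, t) \<in> D" "g z0 \<le> g (x, t)"
    "\<And>y s. (y, s) \<in> D \<Longrightarrow> g (y, s) \<le> g (x, t) + e * dist y x"
proof -
  define R where "R z w \<longleftrightarrow> w \<in> D \<and> e * dist (fst z) (fst w) \<le> g w - g z" for z w
  have "\<exists>z. R z0 z \<and> (\<forall>w. R z w \<longrightarrow> - g w / e = - g z / e)"
  proof (rule closed_preorder_maximal_element[of D R "\<lambda>z. - g z / e" z0])
    show "R z z" if "z \<in> D" for z using that by (simp add: R_def)
    show "R z v" if "R z w" "R w v" for z w v
    proof -
      have "e * dist (fst z) (fst v) \<le> e * (dist (fst z) (fst w) + dist (fst w) (fst v))"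
        using e dist_triangle by (intro mult_left_mono) auto
      then show ?thesis using that by (simp add: R_def algebra_simps)
    qed
    show "w \<in> D" if "R z w" for z w using that by (simp add: R_def)
    show "dist (fst z) (fst w) \<le> - g z / e - - g w / e" if "R z w" for z w
      using that e by (simp add: R_def field_simps)
    show "closed {w. R z w}" for z
    proof -
      have "{w. R z w} = {w \<in> D. e * dist (fst z) (fst w) \<le> g w - g z}" by (auto simp: R_def)
      also have "closed \<dots>"
        using D(1) g(1) by (intro closed_Collect_le continuous_intros continuous_on_closed_Collect_le)
      finally show ?thesis .
    qed
    show "bdd_below ((\<lambda>z. - g z / e) ` D)"
    proof -
      obtain M where "\<And>z. z \<in> D \<Longrightarrow> g z \<le> M" using g(2) by (auto simp: bdd_above_def)
      then show ?thesis using e by (intro bdd_belowI2[of _ "- M / e"]) (simp add: field_simps)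
    qed
  qed (use D z0 in auto)
  then obtain z where z: "R z0 z" "\<And>w. R z w \<Longrightarrow> g w = g z" using e by auto
  show ?thesis
  proof (rule that[of "fst z" "snd z"])
    show "(fst z, snd z) \<in> D" using z(1) by (simp add: R_def)
    have "0 \<le> e * dist (fst z0) (fst z)" using e by simp
    then show "g z0 \<le> g (fst z, snd z)" using z(1) by (simp add: R_def)
    fix y s assume "(y, s) \<in> D"
    show "g (y, s) \<le> g (fst z, snd z) + e * dist y (fst z)"
    proof (rule ccontr)
      assume *: "\<not> ?thesis"
      then have "R z (y, s)" using \<open>(y, s) \<in> D\<close> by (simp add: R_def dist_commute)
      then have "g (y, s) = g z" by (rule z(2))
      moreover have "0 \<le> e * dist y (fst z)" using e by simp
      ultimately show False using * by simp
    qed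
  qed
qed

section \<open>Distance functions in length spaces\<close>

text \<open>On an almost shortest path from \<open>x\<close> to \<open>y\<close> one can stop at distance exactly \<open>r\<close> from \<open>x\<close>, and the
  partition of the path at that point shows that almost no length is wasted.\<close>

lemma length_space_almost_geodesic_point:
  fixes x y :: "'a::metric_space"
  assumes "is_length_space TYPE('a)" and r: "0 < r" "r \<le> dist x y" and e: "e > 0"
  obtains z where "dist x z = r" "dist z y < dist x y - r + e"
proof -
  have "(INF g\<in>{g. path g \<and> pathstart g = x \<and> pathfinish g = y}. curve_length g) < ereal (dist x y + e)"
    using assms(1) e unfolding is_length_space_def by (metis ereal_less(2) less_add_same_cancel1 less_ereal.simps(1))
  then obtain g where g: "path g" "g 0 = x" "g 1 = y" "curve_length g < ereal (dist x y + e)"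
    by (auto simp: INF_less_iff pathstart_def pathfinish_def)
  have "continuous_on {0..1} (\<lambda>s. dist x (g s))"
    using g(1) unfolding path_def by (intro continuous_intros)
  moreover have "dist x (g 0) \<le> r" "r \<le> dist x (g 1)" using g r by auto
  ultimately obtain s where s: "0 \<le> s" "s \<le> 1" "dist x (g s) = r"
    using IVT'[of "\<lambda>s. dist x (g s)" 0 r 1] by auto
  have "ereal (\<Sum>i<length [0,s,1] - 1. dist (g ([0,s,1] ! i)) (g ([0,s,1] ! Suc i))) \<le> curve_length g"
    unfolding curve_length_def using s by (intro SUP_upper) auto
  moreover have "(\<Sum>i<length [0,s,1] - 1. dist (g ([0,s,1] ! i)) (g ([0,s,1] ! Suc i)))
      = dist x (g s) + dist (g s) y"
    using g by (simp add: numeral_2_eq_2)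
  ultimately have "ereal (dist x (g s) + dist (g s) y) < ereal (dist x y + e)"
    using g(4) by (metis le_less_trans)
  then show ?thesis using s by (intro that[of "g s"]) auto
qed

text \<open>For a function of the distance to a fixed point the slope is attained by descending along
  almost geodesics towards that point, so that the slope and the descending slope agree. At the
  centre itself there is nothing to descend to, hence the derivative has to vanish there.\<close>

lemma slope_function_of_dist:
  fixes y :: "'a::metric_space"
  assumes "is_length_space TYPE('a)"
    and \<psi>: "\<And>x'. \<psi> (x', t) = h (dist x' y)"
    and h: "(h has_real_derivative c) (at (dist x y))" and c: "0 \<le> c" "x = y \<Longrightarrow> c = 0"
  shows "slope \<psi> (x, t) = c" "descending_slope \<psi> (x, t) = c"
proof -
  have upper: "\<forall>\<^sub>F x' in at x. \<bar>\<psi> (x, t) - \<psi> (x', t)\<bar> / dist x x' \<le> c + e" if "e > 0" for e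
  proof -
    obtain d where d: "d > 0" "\<And>s. \<bar>s - dist x y\<bar> < d \<Longrightarrow>
        \<bar>h s - h (dist x y) - c * (s - dist x y)\<bar> \<le> e * \<bar>s - dist x y\<bar>"
      using h \<open>e > 0\<close> unfolding has_field_derivative_def has_derivative_at_alt
      by (auto simp: mult.commute)
    have "\<forall>\<^sub>F x' in at x. dist x x' < d \<and> x' \<noteq> x"
      using d(1) by (auto simp: eventually_at dist_commute)
    then show ?thesis
    proof (rule eventually_mono)
      fix x' assume *: "dist x x' < d \<and> x' \<noteq> x"
      have tri: "\<bar>dist x' y - dist x y\<bar> \<le> dist x x'"
        using dist_triangle[of x y x'] dist_triangle[of x' y x] by (simp add: dist_commute abs_le_iff)
      have "\<bar>h (dist x' y) - h (dist x y)\<bar> \<le> \<bar>c * (dist x' y - dist x y)\<bar> + e * \<bar>dist x' y - dist x y\<bar>"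
        using d(2)[of "dist x' y"] tri * by linarith
      also have "\<dots> = (c + e) * \<bar>dist x' y - dist x y\<bar>" using c(1) by (simp add: abs_mult distrib_right)
      also have "\<dots> \<le> (c + e) * dist x x'" using tri c \<open>e > 0\<close> by (intro mult_left_mono) auto
      finally have "\<bar>\<psi> (x, t) - \<psi> (x', t)\<bar> \<le> (c + e) * dist x x'"
        by (simp add: \<psi> abs_minus_commute)
      moreover have "0 < dist x x'" using * by auto
      ultimately show "\<bar>\<psi> (x, t) - \<psi> (x', t)\<bar> / dist x x' \<le> c + e"
        by (simp only: pos_divide_le_eq)
    qed
  qed
  have lower: "\<exists>\<^sub>F x' in at x. c - e < (\<psi> (x, t) - \<psi> (x', t)) / dist x x'" if "e > 0" "c > 0" for e
    unfolding frequently_def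
  proof
    assume "\<forall>\<^sub>F x' in at x. \<not> c - e < (\<psi> (x, t) - \<psi> (x', t)) / dist x x'"
    then obtain d1 where d1: "d1 > 0" "\<And>x'. x' \<noteq> x \<Longrightarrow> dist x' x < d1 \<Longrightarrow>
        \<not> c - e < (\<psi> (x, t) - \<psi> (x', t)) / dist x x'"
      by (auto simp: eventually_at)
    define a where "a = min (e / 2) (c / 2)"
    have a: "a > 0" "a \<le> e/2" "a < c" using that by (auto simp: a_def)
    obtain d where d: "d > 0" "\<And>s. \<bar>s - dist x y\<bar> < d \<Longrightarrow>
        \<bar>h s - h (dist x y) - c * (s - dist x y)\<bar> \<le> a * \<bar>s - dist x y\<bar>"
      using h \<open>a > 0\<close> unfolding has_field_derivative_def has_derivative_at_alt
      by (auto simp: mult.commute)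
    have xy: "x \<noteq> y" using that c by auto
    define r where "r = Min {d1 / 2, d / 2, dist x y}"
    have r: "r > 0" "r < d1" "r < d" "r \<le> dist x y" using d1 d xy by (auto simp: r_def)
    define b where "b = a / c"
    have b: "b > 0" "b < 1" "b * c = a" using a that by (auto simp: b_def)
    obtain x' where x': "dist x x' = r" "dist x' y < dist x y - r + b * r"
      using length_space_almost_geodesic_point[OF assms(1) r(1,4), of "b * r"] b r by auto
    have x'y: "(1 - b) * r \<le> dist x y - dist x' y" "dist x y - dist x' y \<le> r"
      using x' dist_triangle[of x y x'] by (auto simp: algebra_simps)
    have nn: "0 \<le> dist x y - dist x' y" using x'y(1) b r by (smt (verit) mult_nonneg_nonneg)
    have "(c - e) * r < (c - a) * ((1 - b) * r)"
    proof -
      have "(c - a) * (1 - b) = c - 2 * a + a * b" using b(3) by (simp add: algebra_simps)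
      moreover have "a * b > 0" using a b by simp
      ultimately have "c - e < (c - a) * (1 - b)" using a by linarith
      then show ?thesis using r(1) by simp
    qed
    also have "\<dots> \<le> (c - a) * (dist x y - dist x' y)" using a x'y by (intro mult_left_mono) auto
    also have "\<dots> \<le> h (dist x y) - h (dist x' y)"
      using d(2)[of "dist x' y"] nn x'y r by (simp add: algebra_simps abs_le_iff)
    finally have "c - e < (\<psi> (x, t) - \<psi> (x', t)) / dist x x'"
      using x'(1) r(1) by (simp add: \<psi> pos_less_divide_eq)
    moreover have "x' \<noteq> x" "dist x' x < d1" using x' r by (auto simp: dist_commute)
    ultimately show False using d1(2) by blast
  qed
  let ?g = "\<lambda>x'. \<bar>\<psi> (x, t) - \<psi> (x', t)\<bar> / dist x x'"
  let ?h = "\<lambda>x'. max (\<psi> (x, t) - \<psi> (x', t)) 0 / dist x x'"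
  have hg: "?h x' \<le> ?g x'" "(\<psi> (x, t) - \<psi> (x', t)) / dist x x' \<le> ?h x'" for x'
    by (auto intro!: divide_right_mono)
  have upper_h: "\<forall>\<^sub>F x' in at x. ?h x' \<le> c + e" if "e > 0" for e
    using upper[OF that] by (rule eventually_mono) (rule order_trans[OF hg(1)])
  have lower_h: "\<exists>\<^sub>F x' in at x. c - e < ?h x'" if "e > 0" "c > 0" for e
    using lower[OF that] by (rule frequently_elim1) (rule less_le_trans[OF _ hg(2)])
  have lower_g: "\<exists>\<^sub>F x' in at x. c - e < ?g x'" if "e > 0" "c > 0" for e
    using lower_h[OF that] by (rule frequently_elim1) (rule less_le_trans[OF _ hg(1)])
  have "slope \<psi> (x, t) \<le> c"
    by (rule field_le_epsilon) (use c upper in \<open>auto intro!: slope_le\<close>)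
  moreover have "c \<le> slope \<psi> (x, t)"
  proof (cases "c = 0")
    case False
    then show ?thesis unfolding slope_def prod.case
      using upper[of 1] lower_g c by (intro le_real_Limsup[where L="c+1"]) auto
  qed (simp add: slope_nonneg)
  ultimately show "slope \<psi> (x, t) = c" by simp
  have "descending_slope \<psi> (x, t) \<le> c"
    unfolding descending_slope_def prod.case
    by (rule field_le_epsilon) (use c upper_h in \<open>auto intro!: real_Limsup_le\<close>)
  moreover have "c \<le> descending_slope \<psi> (x, t)"
  proof (cases "c = 0")
    case True
    then show ?thesis unfolding descending_slope_def prod.case by (simp add: real_Limsup_nonneg)
  next
    case False
    then show ?thesis unfolding descending_slope_def prod.case
      using upper_h[of 1] lower_h c by (intro le_real_Limsup[where L="c+1"]) auto
  qed
  ultimately show "descending_slope \<psi> (x, t) = c" by simp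
qed

section \<open>Stability of locally Lipschitz functions\<close>

lemma locally_lipschitz_onI:
  fixes u :: "'a::metric_space \<Rightarrow> real"
  assumes "\<And>z. z \<in> S \<Longrightarrow> \<exists>r>0. \<exists>L. \<forall>w\<in>ball z r \<inter> S. \<forall>w'\<in>ball z r \<inter> S. \<bar>u w - u w'\<bar> \<le> L * dist w w'"
  shows "locally_lipschitz_on S u"
  unfolding locally_lipschitz_on_def
proof
  fix z assume "z \<in> S"
  then obtain r L where r: "r > 0"
    "\<And>w w'. w \<in> ball z r \<inter> S \<Longrightarrow> w' \<in> ball z r \<inter> S \<Longrightarrow> \<bar>u w - u w'\<bar> \<le> L * dist w w'"
    using assms by meson
  have "\<bar>L\<bar>-lipschitz_on (ball z r \<inter> S) u"
  proof (rule lipschitz_onI)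
    fix w w' assume "w \<in> ball z r \<inter> S" "w' \<in> ball z r \<inter> S"
    then have "\<bar>u w - u w'\<bar> \<le> L * dist w w'" by (rule r)
    also have "\<dots> \<le> \<bar>L\<bar> * dist w w'" by (intro mult_right_mono) auto
    finally show "dist (u w) (u w') \<le> \<bar>L\<bar> * dist w w'" by (simp add: dist_real_def)
  qed simp
  then show "\<exists>r>0. \<exists>L. L-lipschitz_on (ball z r \<inter> S) u" using r(1) by blast
qed

lemma lipschitz_imp_locally_lipschitz:
  assumes "\<And>w w'. \<bar>u w - u w'\<bar> \<le> L * dist w w'"
  shows "locally_lipschitz_on S u"
  using assms by (intro locally_lipschitz_onI exI[of _ "1::real"] conjI exI[of _ L]) auto

lemma locally_lipschitz_on_add:
  assumes "locally_lipschitz_on S u" "locally_lipschitz_on S v"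
  shows "locally_lipschitz_on S (\<lambda>z. u z + v z)"
  unfolding locally_lipschitz_on_def
proof
  fix z assume "z \<in> S"
  then obtain r1 L1 r2 L2 where "r1 > 0" "L1-lipschitz_on (ball z r1 \<inter> S) u"
    "r2 > 0" "L2-lipschitz_on (ball z r2 \<inter> S) v"
    using assms unfolding locally_lipschitz_on_def by blast
  moreover have "ball z (min r1 r2) \<inter> S \<subseteq> ball z r1 \<inter> S" "ball z (min r1 r2) \<inter> S \<subseteq> ball z r2 \<inter> S"
    by auto
  ultimately have "(L1 + L2)-lipschitz_on (ball z (min r1 r2) \<inter> S) (\<lambda>z. u z + v z)"
    by (intro lipschitz_on_add) (auto intro: lipschitz_on_subset)
  then show "\<exists>r>0. \<exists>L. L-lipschitz_on (ball z r \<inter> S) (\<lambda>z. u z + v z)"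
    using \<open>r1 > 0\<close> \<open>r2 > 0\<close> by (intro exI[of _ "min r1 r2"]) auto
qed

lemma locally_lipschitz_on_mult:
  assumes "locally_lipschitz_on S u" "locally_lipschitz_on S v"
  shows "locally_lipschitz_on S (\<lambda>z. u z * v z)"
proof (rule locally_lipschitz_onI)
  fix z assume z: "z \<in> S"
  then obtain r1 L1 r2 L2 where L: "r1 > 0" "L1-lipschitz_on (ball z r1 \<inter> S) u"
    "r2 > 0" "L2-lipschitz_on (ball z r2 \<inter> S) v"
    using assms unfolding locally_lipschitz_on_def by blast
  define r where "r = min r1 r2"
  define M where "M = \<bar>u z\<bar> + L1 * r + (\<bar>v z\<bar> + L2 * r)"
  have r: "r > 0" using L by (simp add: r_def)
  have sub: "ball z r \<inter> S \<subseteq> ball z r1 \<inter> S" "ball z r \<inter> S \<subseteq> ball z r2 \<inter> S" by (auto simp: r_def)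
  have nn: "0 \<le> L1" "0 \<le> L2" using L by (auto intro: lipschitz_on_nonneg)
  have lu: "\<bar>u w - u w'\<bar> \<le> L1 * dist w w'" "\<bar>v w - v w'\<bar> \<le> L2 * dist w w'"
    if "w \<in> ball z r \<inter> S" "w' \<in> ball z r \<inter> S" for w w'
    using that sub lipschitz_onD[OF L(2), of w w'] lipschitz_onD[OF L(4), of w w']
    by (auto simp: dist_real_def subset_iff)
  have bd: "\<bar>u w\<bar> \<le> M" "\<bar>v w\<bar> \<le> M" if "w \<in> ball z r \<inter> S" for w
  proof -
    have "z \<in> ball z r \<inter> S" using z r by simp
    note lu[OF that this]
    moreover have "L1 * dist w z \<le> L1 * r" "L2 * dist w z \<le> L2 * r" "0 \<le> L1 * r" "0 \<le> L2 * r"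
      using that nn r by (auto simp: dist_commute intro!: mult_left_mono)
    ultimately show "\<bar>u w\<bar> \<le> M" "\<bar>v w\<bar> \<le> M" unfolding M_def by linarith+
  qed
  have "\<bar>u w * v w - u w' * v w'\<bar> \<le> (M * L2 + M * L1) * dist w w'"
    if "w \<in> ball z r \<inter> S" "w' \<in> ball z r \<inter> S" for w w'
  proof -
    have "u w * v w - u w' * v w' = u w * (v w - v w') + v w' * (u w - u w')"
      by (simp add: algebra_simps)
    also have "\<bar>\<dots>\<bar> \<le> \<bar>u w\<bar> * \<bar>v w - v w'\<bar> + \<bar>v w'\<bar> * \<bar>u w - u w'\<bar>"
      by (simp add: abs_mult[symmetric] abs_triangle_ineq)
    also have "\<dots> \<le> M * (L2 * dist w w') + M * (L1 * dist w w')"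
      using bd[OF that(1)] bd[OF that(2)] lu[OF that] by (intro add_mono mult_mono) auto
    finally show ?thesis by (simp add: algebra_simps)
  qed
  then show "\<exists>r>0. \<exists>L. \<forall>w\<in>ball z r \<inter> S. \<forall>w'\<in>ball z r \<inter> S. \<bar>u w * v w - u w' * v w'\<bar> \<le> L * dist w w'"
    using r by blast
qed

lemma locally_lipschitz_on_max_0:
  assumes "locally_lipschitz_on S u"
  shows "locally_lipschitz_on S (\<lambda>z. max (u z) 0)"
  unfolding locally_lipschitz_on_def
proof
  fix z assume "z \<in> S"
  then obtain r L where r: "r > 0" "L-lipschitz_on (ball z r \<inter> S) u"
    using assms unfolding locally_lipschitz_on_def by blast
  have "L-lipschitz_on (ball z r \<inter> S) (\<lambda>z. max (u z) 0)"
  proof (rule lipschitz_onI)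
    fix w w' assume "w \<in> ball z r \<inter> S" "w' \<in> ball z r \<inter> S"
    from lipschitz_onD[OF r(2) this]
    show "dist (max (u w) 0) (max (u w') 0) \<le> L * dist w w'" by (auto simp: dist_real_def)
  qed (use r in \<open>auto intro: lipschitz_on_nonneg\<close>)
  then show "\<exists>r>0. \<exists>L. L-lipschitz_on (ball z r \<inter> S) (\<lambda>z. max (u z) 0)" using r(1) by blast
qed

lemma locally_lipschitz_on_const: "locally_lipschitz_on S (\<lambda>z. c)"
  by (rule lipschitz_imp_locally_lipschitz[of _ 0]) simp

lemma locally_lipschitz_on_snd: "locally_lipschitz_on S snd"
  by (rule lipschitz_imp_locally_lipschitz[of _ 1]) (metis dist_real_def dist_snd_le mult_1)

lemma locally_lipschitz_on_dist_fst: "locally_lipschitz_on S (\<lambda>z. dist (fst z) y)"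
proof (rule lipschitz_imp_locally_lipschitz[of _ 1])
  fix w w' :: "'a \<times> 'b"
  have "\<bar>dist (fst w) y - dist (fst w') y\<bar> \<le> dist (fst w) (fst w')"
    using dist_triangle[of "fst w" y "fst w'"] dist_triangle[of "fst w'" y "fst w"]
    by (simp add: dist_commute abs_le_iff)
  also have "\<dots> \<le> dist w w'" by (rule dist_fst_le)
  finally show "\<bar>dist (fst w) y - dist (fst w') y\<bar> \<le> 1 * dist w w'" by simp
qed

section \<open>Cone-shaped test functions\<close>

text \<open>For \<open>A, B \<ge> 0\<close> this is an affine function of time with a penalty where
  \<open>(dist x y)\<^sup>2 > (t - b)\<^sup>2 + k\<close> and a penalty after the time \<open>t1\<close>. In the region where the first
  penalty acts, its slope exceeds the absolute value of its time derivative outside the light cone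
  \<open>dist x y \<le> \<bar>t - b\<bar>\<close> with tip \<open>(y, b)\<close>, and the converse holds in the interior of that cone; the
  sign of \<open>k\<close> decides which region matters. The distance enters through its square because the
  distance itself has slope \<open>1\<close> but descending slope \<open>0\<close> at the centre \<open>y\<close>.\<close>

definition cone_test ::
  "'a::metric_space \<Rightarrow> real \<Rightarrow> real \<Rightarrow> real \<Rightarrow> real \<Rightarrow> real \<Rightarrow> real \<Rightarrow> real \<Rightarrow> 'a \<times> real \<Rightarrow> real" where
  "cone_test y b k A t1 B c a = (\<lambda>(x, t).
     c + a * t + A * (max ((dist x y)\<^sup>2 - (t - b)\<^sup>2 - k) 0)\<^sup>2 + B * (max (t - t1) 0)\<^sup>2)"

text \<open>Squaring the positive part keeps the penalties continuously differentiable.\<close>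

lemma DERIV_max_0_power2:
  "((\<lambda>s. (max s 0)\<^sup>2) has_real_derivative 2 * max s 0) (at (s::real))"
proof -
  consider "s > 0" | "s < 0" | "s = 0" by linarith
  then show ?thesis
  proof cases
    case 1
    have "((\<lambda>s. s\<^sup>2) has_real_derivative 2 * s) (at s)"
      by (auto intro!: derivative_eq_intros)
    then have "((\<lambda>s. s\<^sup>2) has_real_derivative 2 * max s 0) (at s)"
      using 1 by simp
    moreover have "\<forall>\<^sub>F s' in nhds s. (s' :: real) > 0"
      using 1 eventually_nhds_in_open[of "{0<..}" s] by simp
    then have "\<forall>\<^sub>F s' in nhds s. (max s' 0)\<^sup>2 = s'\<^sup>2" by (rule eventually_mono) simp
    ultimately show ?thesis by (subst DERIV_cong_ev[OF refl _ refl])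
  next
    case 2
    have "((\<lambda>s. 0) has_real_derivative 2 * max s 0) (at s)"
      using 2 by simp
    moreover have "\<forall>\<^sub>F s' in nhds s. (s' :: real) < 0"
      using 2 eventually_nhds_in_open[of "{..<0}" s] by simp
    then have "\<forall>\<^sub>F s' in nhds s. (max s' 0)\<^sup>2 = 0" by (rule eventually_mono) simp
    ultimately show ?thesis by (subst DERIV_cong_ev[OF refl _ refl])
  next
    case 3
    have "((\<lambda>h. (max h 0)\<^sup>2 / h) \<longlongrightarrow> 0) (at (0::real))"
    proof (rule Lim_null_comparison)
      show "\<forall>\<^sub>F h in at (0::real). norm ((max h 0)\<^sup>2 / h) \<le> \<bar>h\<bar>"
        by (intro always_eventually) (auto simp: max_def power2_eq_square)
    qed (auto intro!: tendsto_eq_intros)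
    then show ?thesis using 3 by (simp add: DERIV_def)
  qed
qed

lemma DERIV_max_0_power2_chain:
  assumes "(u has_real_derivative D) (at s)"
  shows "((\<lambda>s. (max (u s) 0)\<^sup>2) has_real_derivative 2 * max (u s) 0 * D) (at (s::real))"
  using DERIV_chain2[OF DERIV_max_0_power2 assms] .

lemma DERIV_cone_test:
  "((\<lambda>s. cone_test y b k A t1 B c a (x, s)) has_real_derivative
     a - 4 * A * max ((dist x y)\<^sup>2 - (t - b)\<^sup>2 - k) 0 * (t - b) + 2 * B * max (t - t1) 0) (at t)"
proof -
  let ?P = "(dist x y)\<^sup>2 - (t - b)\<^sup>2 - k"
  have P: "((\<lambda>s. (dist x y)\<^sup>2 - (s - b)\<^sup>2 - k) has_real_derivative - (2 * (t - b))) (at t)"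
    and top: "((\<lambda>s. s - t1) has_real_derivative 1) (at t)"
    by (auto intro!: derivative_eq_intros)
  have "((\<lambda>s. c + a * s + A * (max ((dist x y)\<^sup>2 - (s - b)\<^sup>2 - k) 0)\<^sup>2 + B * (max (s - t1) 0)\<^sup>2)
      has_real_derivative
      0 + a * 1 + A * (2 * max ?P 0 * - (2 * (t - b))) + B * (2 * max (t - t1) 0 * 1)) (at t)"
    by (intro DERIV_add DERIV_const DERIV_cmult DERIV_ident
        DERIV_max_0_power2_chain[OF P] DERIV_max_0_power2_chain[OF top])
  then show ?thesis unfolding cone_test_def prod.case
    by (rule DERIV_cong) algebra
qed

lemma locally_lipschitz_on_cone_test: "locally_lipschitz_on S (cone_test y b k A t1 B c a)"
proof -
  have *: "cone_test y b k A t1 B c a = (\<lambda>z. c + a * snd z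
     + A * (max (dist (fst z) y * dist (fst z) y + (-1) * ((snd z + - b) * (snd z + - b)) + - k) 0
          * max (dist (fst z) y * dist (fst z) y + (-1) * ((snd z + - b) * (snd z + - b)) + - k) 0)
     + B * (max (snd z + - t1) 0 * max (snd z + - t1) 0))"
    by (simp add: cone_test_def power2_eq_square case_prod_unfold)
  show ?thesis unfolding *
    by (intro locally_lipschitz_on_add locally_lipschitz_on_mult locally_lipschitz_on_max_0
        locally_lipschitz_on_const locally_lipschitz_on_snd locally_lipschitz_on_dist_fst)
qed

lemma slope_cone_test:
  fixes y :: "'a::metric_space"
  assumes "is_length_space TYPE('a)" "0 \<le> A"
  shows "slope (cone_test y b k A t1 B c a) (x, t)
      = 4 * A * max ((dist x y)\<^sup>2 - (t - b)\<^sup>2 - k) 0 * dist x y"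
    and "descending_slope (cone_test y b k A t1 B c a) (x, t)
      = 4 * A * max ((dist x y)\<^sup>2 - (t - b)\<^sup>2 - k) 0 * dist x y"
proof -
  let ?h = "\<lambda>s. c + a * t + A * (max (s\<^sup>2 - (t - b)\<^sup>2 - k) 0)\<^sup>2 + B * (max (t - t1) 0)\<^sup>2"
  have h: "(?h has_real_derivative 4 * A * max ((dist x y)\<^sup>2 - (t - b)\<^sup>2 - k) 0 * dist x y) (at (dist x y))"
  proof -
    have P: "((\<lambda>s. s\<^sup>2 - (t - b)\<^sup>2 - k) has_real_derivative 2 * dist x y) (at (dist x y))"
      by (auto intro!: derivative_eq_intros)
    have "(?h has_real_derivative
        0 + A * (2 * max ((dist x y)\<^sup>2 - (t - b)\<^sup>2 - k) 0 * (2 * dist x y)) + 0) (at (dist x y))"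
      by (intro DERIV_add DERIV_const DERIV_cmult DERIV_max_0_power2_chain[OF P])
    then show ?thesis by (rule DERIV_cong) algebra
  qed
  have c: "cone_test y b k A t1 B c a (x', t) = ?h (dist x' y)" for x'
    by (simp add: cone_test_def)
  have nn: "0 \<le> 4 * A * max ((dist x y)\<^sup>2 - (t - b)\<^sup>2 - k) 0 * dist x y"
    using assms(2) by simp
  show "slope (cone_test y b k A t1 B c a) (x, t)
      = 4 * A * max ((dist x y)\<^sup>2 - (t - b)\<^sup>2 - k) 0 * dist x y"
    by (rule slope_function_of_dist(1)[OF assms(1) c h nn]) simp
  show "descending_slope (cone_test y b k A t1 B c a) (x, t)
      = 4 * A * max ((dist x y)\<^sup>2 - (t - b)\<^sup>2 - k) 0 * dist x y"
    by (rule slope_function_of_dist(2)[OF assms(1) c h nn]) simp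
qed

lemma slope_dist_le:
  assumes "0 \<le> e"
  shows "slope (\<lambda>z. e * dist (fst z) x0) w \<le> e"
proof -
  have "\<bar>e * dist x x0 - e * dist y x0\<bar> / dist x y \<le> e" for x y
  proof -
    have "\<bar>dist x x0 - dist y x0\<bar> \<le> dist x y"
      using dist_triangle[of x x0 y] dist_triangle[of y x0 x] by (simp add: dist_commute abs_le_iff)
    then have "e * \<bar>dist x x0 - dist y x0\<bar> \<le> e * dist x y" using assms by (intro mult_left_mono)
    then have *: "\<bar>e * dist x x0 - e * dist y x0\<bar> \<le> e * dist x y"
      using assms by (simp add: abs_mult right_diff_distrib[symmetric])
    show ?thesis
    proof (cases "x = y")
      case False
      then show ?thesis using * by (simp add: pos_divide_le_eq)
    qed (use assms in simp)
  qed
  then show ?thesis using assms by (cases w) (auto intro!: slope_le)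
qed

lemma sub_test_cone_test:
  fixes y :: "'a::metric_space"
  assumes "is_length_space TYPE('a)" "0 \<le> A"
  shows "sub_test T (cone_test y b k A t1 B c a) (\<lambda>z. e * dist (fst z) x0)"
proof -
  have slope: "slope (cone_test y b k A t1 B c a)
      = (\<lambda>z. 4 * A * max ((dist (fst z) y)\<^sup>2 - (snd z - b)\<^sup>2 - k) 0 * dist (fst z) y)"
    using slope_cone_test(1)[OF assms] by auto
  have "dt (cone_test y b k A t1 B c a) = (\<lambda>z.
      a - 4 * A * max ((dist (fst z) y)\<^sup>2 - (snd z - b)\<^sup>2 - k) 0 * (snd z - b)
        + 2 * B * max (snd z - t1) 0)"
  proof (rule ext)
    fix z :: "'a \<times> real"
    show "dt (cone_test y b k A t1 B c a) z =
        a - 4 * A * max ((dist (fst z) y)\<^sup>2 - (snd z - b)\<^sup>2 - k) 0 * (snd z - b)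
        + 2 * B * max (snd z - t1) 0"
      by (cases z) (simp only: dt_eqI[OF DERIV_cone_test] fst_conv snd_conv)
  qed
  then have cont: "continuous_on (cyl T) (dt (cone_test y b k A t1 B c a))"
    by (auto intro!: continuous_intros)
  have "continuous_dt_on_cyl T (cone_test y b k A t1 B c a)"
    unfolding continuous_dt_on_cyl_def field_differentiable_def
    by (intro conjI allI ballI exI cont, rule DERIV_cone_test)
  moreover have "continuous_dt_on_cyl T (\<lambda>z. e * dist (fst z) x0)"
  proof -
    have *: "((\<lambda>s. e * dist (fst (x, s)) x0) has_real_derivative 0) (at t)" for x and t :: real by simp
    have "dt (\<lambda>z. e * dist (fst z) x0) = (\<lambda>z. 0)"
      using dt_eqI[OF *] by auto
    then have cont: "continuous_on (cyl T) (dt (\<lambda>z. e * dist (fst z) x0))" by simp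
    show ?thesis unfolding continuous_dt_on_cyl_def field_differentiable_def
      by (intro conjI allI ballI exI cont, rule *)
  qed
  moreover have "locally_lipschitz_on (cyl T) (\<lambda>z. e * dist (fst z) x0)"
    by (intro locally_lipschitz_on_mult locally_lipschitz_on_const locally_lipschitz_on_dist_fst)
  moreover have "continuous_on (cyl T) (slope (cone_test y b k A t1 B c a))"
    unfolding slope by (intro continuous_intros)
  ultimately show ?thesis
    using locally_lipschitz_on_cone_test slope_cone_test[OF assms] unfolding sub_test_def by force
qed

text \<open>The perturbation supplied by the variational principle enters as the second part of the test
  function and costs at most its Lipschitz constant \<open>e\<close> in the equation.\<close>

lemma subsolution_inequality_at_perturbed_max:
  fixes y :: "'a::metric_space"
  assumes "is_length_space TYPE('a)" "slope_subsolution T f u" "0 \<le> A" "0 \<le> e" "0 < t" "t < T"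
    and "open N" "(x, t) \<in> N"
    and "\<And>x' t'. (x', t') \<in> N \<Longrightarrow> u (x', t') - cone_test y b k A t1 B c a (x', t')
       \<le> u (x, t) - cone_test y b k A t1 B c a (x, t) + e * dist x' x"
  shows "a + 4 * A * max ((dist x y)\<^sup>2 - (t - b)\<^sup>2 - k) 0 * (dist x y - (t - b))
    + 2 * B * max (t - t1) 0 - e \<le> f x"
proof -
  let ?\<psi>1 = "cone_test y b k A t1 B c a" and ?\<psi>2 = "\<lambda>z. e * dist (fst z) x"
  let ?p = "4 * A * max ((dist x y)\<^sup>2 - (t - b)\<^sup>2 - k) 0"
  have test: "sub_test T ?\<psi>1 ?\<psi>2" by (rule sub_test_cone_test) (use assms in auto)
  have "\<forall>\<^sub>F w in at (x, t) within cyl T. w \<in> N"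
    using assms(7,8) by (metis eventually_at_topological)
  then have "has_local_max_at (cyl T) (\<lambda>z. u z - (?\<psi>1 z + ?\<psi>2 z)) (x, t)"
    unfolding has_local_max_at_def
  proof (rule eventually_mono)
    fix w assume "w \<in> N"
    then show "u w - (?\<psi>1 w + ?\<psi>2 w) \<le> u (x, t) - (?\<psi>1 (x, t) + ?\<psi>2 (x, t))"
      using assms(9)[of "fst w" "snd w"] by simp
  qed
  then have "dt (\<lambda>z. ?\<psi>1 z + ?\<psi>2 z) (x, t) +
      hamil_lower f (usc_envelope (slope ?\<psi>2) (x, t)) x (slope ?\<psi>1 (x, t)) \<le> 0"
    using assms(2,5,6) test unfolding slope_subsolution_def by force
  moreover have "dt (\<lambda>z. ?\<psi>1 z + ?\<psi>2 z) (x, t) = a - ?p * (t - b) + 2 * B * max (t - t1) 0"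
  proof (rule dt_eqI)
    have "((\<lambda>s. e * dist (fst (x, s)) x) has_real_derivative 0) (at t)" by simp
    from DERIV_add[OF DERIV_cone_test this]
    show "((\<lambda>s. ?\<psi>1 (x, s) + ?\<psi>2 (x, s)) has_real_derivative
      a - ?p * (t - b) + 2 * B * max (t - t1) 0) (at t)" by (simp only: add_0_right)
  qed
  moreover have "usc_envelope (slope ?\<psi>2) (x, t) \<le> e"
    using slope_dist_le[OF assms(4)] by (rule usc_envelope_slope_le)
  moreover have "slope ?\<psi>1 (x, t) = ?p * dist x y"
    using slope_cone_test(1)[OF assms(1,3)] .
  ultimately have "a - ?p * (t - b) + 2 * B * max (t - t1) 0
      + (max (?p * dist x y - usc_envelope (slope ?\<psi>2) (x, t)) 0 - f x) \<le> 0"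
    and "usc_envelope (slope ?\<psi>2) (x, t) \<le> e"
    by (simp_all only: hamil_lower_eq[OF usc_envelope_slope_nonneg])
  moreover have "?p * (dist x y - (t - b)) = ?p * dist x y - ?p * (t - b)"
    by (rule right_diff_distrib)
  moreover have "?p * dist x y - usc_envelope (slope ?\<psi>2) (x, t)
      \<le> max (?p * dist x y - usc_envelope (slope ?\<psi>2) (x, t)) 0" by (rule max.cobounded1)
  ultimately show ?thesis by linarith
qed

lemma supersolution_inequality_at_perturbed_min:
  fixes y :: "'a::metric_space"
  assumes "is_length_space TYPE('a)" "slope_supersolution T f u" "0 \<le> A" "0 \<le> e" "0 < t" "t < T"
    and "open N" "(x, t) \<in> N"
    and "\<And>x' t'. (x', t') \<in> N \<Longrightarrow> - u (x', t') - cone_test y b k A t1 B c a (x', t')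
       \<le> - u (x, t) - cone_test y b k A t1 B c a (x, t) + e * dist x' x"
  shows "f x \<le> - a + 4 * A * max ((dist x y)\<^sup>2 - (t - b)\<^sup>2 - k) 0 * (dist x y + (t - b))
    - 2 * B * max (t - t1) 0 + e"
proof -
  let ?\<psi>1 = "\<lambda>z. - cone_test y b k A t1 B c a z" and ?\<psi>2 = "\<lambda>z. - (e * dist (fst z) x)"
  let ?p = "4 * A * max ((dist x y)\<^sup>2 - (t - b)\<^sup>2 - k) 0"
  have slope_minus: "slope (\<lambda>z. - \<psi> z) = slope \<psi>" for \<psi> :: "'a \<times> real \<Rightarrow> real"
    unfolding slope_def by (simp add: abs_minus_commute)
  have test: "super_test T ?\<psi>1 ?\<psi>2" unfolding super_test_def minus_minus
    by (rule sub_test_cone_test) (use assms in auto)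
  have "\<forall>\<^sub>F w in at (x, t) within cyl T. w \<in> N"
    using assms(7,8) by (metis eventually_at_topological)
  then have "has_local_min_at (cyl T) (\<lambda>z. u z - (?\<psi>1 z + ?\<psi>2 z)) (x, t)"
    unfolding has_local_min_at_def
  proof (rule eventually_mono)
    fix w assume "w \<in> N"
    then show "u (x, t) - (?\<psi>1 (x, t) + ?\<psi>2 (x, t)) \<le> u w - (?\<psi>1 w + ?\<psi>2 w)"
      using assms(9)[of "fst w" "snd w"] by simp
  qed
  then have "0 \<le> dt (\<lambda>z. ?\<psi>1 z + ?\<psi>2 z) (x, t) +
      hamil_upper f (usc_envelope (slope ?\<psi>2) (x, t)) x (slope ?\<psi>1 (x, t))"
    using assms(2,5,6) test unfolding slope_supersolution_def by force
  moreover have "dt (\<lambda>z. ?\<psi>1 z + ?\<psi>2 z) (x, t) = - (a - ?p * (t - b) + 2 * B * max (t - t1) 0)"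
  proof (rule dt_eqI)
    have "((\<lambda>s. - (e * dist (fst (x, s)) x)) has_real_derivative 0) (at t)" by simp
    from DERIV_add[OF DERIV_minus[OF DERIV_cone_test] this]
    show "((\<lambda>s. ?\<psi>1 (x, s) + ?\<psi>2 (x, s)) has_real_derivative
      - (a - ?p * (t - b) + 2 * B * max (t - t1) 0)) (at t)" by (simp only: add_0_right)
  qed
  moreover have "usc_envelope (slope ?\<psi>2) (x, t) \<le> e"
    unfolding slope_minus using slope_dist_le[OF assms(4)] by (rule usc_envelope_slope_le)
  moreover have "slope ?\<psi>1 (x, t) = ?p * dist x y"
    unfolding slope_minus using slope_cone_test(1)[OF assms(1,3)] .
  moreover have "hamil_upper f (usc_envelope (slope ?\<psi>2) (x, t)) x (slope ?\<psi>1 (x, t))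
      = slope ?\<psi>1 (x, t) + usc_envelope (slope ?\<psi>2) (x, t) - f x"
    by (rule hamil_upper_eq[OF usc_envelope_slope_nonneg slope_nonneg])
  ultimately have "0 \<le> - (a - ?p * (t - b) + 2 * B * max (t - t1) 0)
      + (?p * dist x y + usc_envelope (slope ?\<psi>2) (x, t) - f x)"
    and "usc_envelope (slope ?\<psi>2) (x, t) \<le> e"
    by (simp_all only:)
  moreover have "?p * (dist x y + (t - b)) = ?p * dist x y + ?p * (t - b)"
    by (rule distrib_left)
  ultimately show ?thesis by linarith
qed

section \<open>Local comparison with cones\<close>

lemma cyl_nbhd:
  fixes f :: "'a::metric_space \<Rightarrow> real" and u :: "'a \<times> real \<Rightarrow> real"
  assumes "continuous_on (cyl T) u" "continuous_on UNIV f" "0 < t0" "t0 < T" "e > 0"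
  obtains R where "R > 0"
    "\<And>x t. dist x x0 < R \<Longrightarrow> \<bar>t - t0\<bar> < R \<Longrightarrow>
       0 < t \<and> t < T \<and> \<bar>f x - f x0\<bar> < e \<and> \<bar>u (x, t) - u (x0, t0)\<bar> < 1"
proof -
  have "(x0, t0) \<in> cyl T" using assms by (simp add: cylI)
  then obtain d1 where d1: "d1 > 0" "\<And>w. w \<in> cyl T \<Longrightarrow> dist w (x0, t0) < d1 \<Longrightarrow> \<bar>u w - u (x0, t0)\<bar> < 1"
    using assms(1) unfolding continuous_on_iff dist_real_def by (metis zero_less_one)
  obtain d2 where d2: "d2 > 0" "\<And>x. dist x x0 < d2 \<Longrightarrow> \<bar>f x - f x0\<bar> < e"
    using assms(2,5) unfolding continuous_on_iff dist_real_def by (metis UNIV_I)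
  let ?R = "min (min (d1/2) d2) (min t0 (T - t0))"
  show ?thesis
  proof (rule that[of ?R])
    show "?R > 0" using assms d1 d2 by auto
    fix x t assume *: "dist x x0 < ?R" "\<bar>t - t0\<bar> < ?R"
    have "dist (x, t) (x0, t0) \<le> dist x x0 + \<bar>t - t0\<bar>"
      using sqrt_sum_squares_le_sum_abs[of "dist x x0" "dist t t0"]
      by (simp add: dist_Pair_Pair dist_real_def)
    then have "dist (x, t) (x0, t0) < d1" using * by auto
    moreover have "0 < t" "t < T" using * by auto
    ultimately show "0 < t \<and> t < T \<and> \<bar>f x - f x0\<bar> < e \<and> \<bar>u (x, t) - u (x0, t0)\<bar> < 1"
      using d1 d2 * by (auto simp: cylI)
  qed
qed

text \<open>A subsolution obeys the dynamic programming inequality along every motion of speed at most one,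
  locally and with the running cost frozen at a value \<open>F\<close> slightly above \<open>f x0\<close>.
  If it failed between \<open>(y, s)\<close> and \<open>(x, t)\<close>, one could start a comparison function \<open>W\<close> at time \<open>s\<close>
  from \<open>u (x, t) - F * (t - s) > u (y, s)\<close>, let it grow at the rate \<open>F\<close>, and penalise it slightly
  outside the forward light cone of \<open>(y, s)\<close> and after time \<open>t\<close>. Then \<open>u - W\<close> vanishes at \<open>(x, t)\<close>
  but is negative at the initial time, at the final time and on the lateral boundary, so a perturbed
  maximum is interior. The subsolution inequality there, with an error \<open>e\<close> for the perturbation,
  says \<open>F - e \<le> f\<close>, because the penalties only increase the sum of the time derivative and the slope
  of \<open>W\<close>; but \<open>f < F - e\<close> near \<open>x0\<close>.\<close>

proposition subsolution_le_along_motion: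
  fixes f :: "'a::complete_space \<Rightarrow> real" and u :: "'a \<times> real \<Rightarrow> real"
  assumes X: "is_length_space TYPE('a)" and sub: "slope_subsolution T f u"
    and u: "continuous_on (cyl T) u" and f: "continuous_on UNIV f"
    and t0: "0 < t0" "t0 < T" and F: "f x0 < F"
  obtains r where "r > 0"
    "\<And>x y s t. dist x x0 < r \<Longrightarrow> \<bar>s - t0\<bar> < r \<Longrightarrow> \<bar>t - t0\<bar> < r \<Longrightarrow> dist x y \<le> t - s \<Longrightarrow>
       u (x, t) \<le> u (y, s) + F * (t - s)"
proof -
  define e where "e = (F - f x0) / 2"
  have e: "e > 0" using F by (simp add: e_def)
  obtain R where R: "R > 0" "\<And>x t. dist x x0 < R \<Longrightarrow> \<bar>t - t0\<bar> < R \<Longrightarrow>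
       0 < t \<and> t < T \<and> \<bar>f x - f x0\<bar> < e \<and> \<bar>u (x, t) - u (x0, t0)\<bar> < 1"
    using cyl_nbhd[OF u f t0 e] by metis
  define r where "r = R / 8"
  have r: "r > 0" using R by (simp add: r_def)
  show ?thesis
  proof (rule that[OF r], rule ccontr)
    fix x y s t
    assume near: "dist x x0 < r" "\<bar>s - t0\<bar> < r" "\<bar>t - t0\<bar> < r" and d: "dist x y \<le> t - s"
      and contra: "\<not> u (x, t) \<le> u (y, s) + F * (t - s)"
    have "0 \<le> t - s" using d zero_le_dist order_trans by blast
    moreover have "t \<noteq> s" using d contra by auto
    ultimately have st: "s < t" by simp
    have yx0: "dist y x0 < 3 * r"
      using dist_triangle[of y x0 x] near d by (simp add: dist_commute)
    define m where "m = u (x, t) - F * (t - s)"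
    have m: "u (y, s) < m" using contra by (simp add: m_def)
    have ys: "(y, s) \<in> cyl T" using R(2)[of y s] near yx0 r by (auto simp: cylI r_def)
    obtain k0 where k0: "k0 > 0" "\<And>w. w \<in> cyl T \<Longrightarrow> dist w (y, s) < k0 \<Longrightarrow> \<bar>u w - u (y, s)\<bar> < m - u (y, s)"
      using u ys m unfolding continuous_on_iff dist_real_def by (metis diff_gt_0_iff_gt)
    \<comment> \<open>Nearer to \<open>y\<close> than \<open>h\<close>, continuity gives \<open>u < m\<close> at time \<open>s\<close>; from the distance \<open>h\<close> on, the
      penalty is at least \<open>A * k\<^sup>2\<close>, and by \<open>k \<le> r\<^sup>2\<close> also on the lateral boundary at distance \<open>4 * r\<close>.\<close>
    define h where "h = min k0 r"
    define k where "k = h\<^sup>2 / 2"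
    have h: "h > 0" "h \<le> k0" "h \<le> r" using k0 r by (auto simp: h_def)
    have k: "k > 0" "k \<le> r\<^sup>2"
    proof -
      have "h\<^sup>2 \<le> r\<^sup>2" using h by (intro power_mono) auto
      moreover have "0 < h\<^sup>2" using h by simp
      ultimately show "k > 0" "k \<le> r\<^sup>2" unfolding k_def by linarith+
    qed
    \<comment> \<open>\<open>K\<close> exceeds the oscillation of \<open>u\<close> and of the affine part of \<open>W\<close> on the domain \<open>D\<close> below.\<close>
    define K where "K = 3 + 5 * r * \<bar>F\<bar>"
    have K: "K > 0" using r by (simp add: K_def add_pos_nonneg)
    define A B where "A = K / k\<^sup>2" and "B = K / r\<^sup>2"
    have A: "A > 0" "A * k\<^sup>2 = K" using K k by (auto simp: A_def)
    have B: "B > 0" "B * r\<^sup>2 = K" using K r by (auto simp: B_def)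
    define W where "W = cone_test y s k A t B (m - F * s) F"
    have W: "W (x', t') = m + F * (t' - s) + A * (max ((dist x' y)\<^sup>2 - (t' - s)\<^sup>2 - k) 0)\<^sup>2
        + B * (max (t' - t) 0)\<^sup>2" for x' t'
      by (simp add: W_def cone_test_def algebra_simps)
    define D where "D = cball y (4 * r) \<times> {s..t + r}"
    have Din: "dist x' x0 < R" "\<bar>t' - t0\<bar> < R" "dist x' y \<le> 4 * r" "s \<le> t'" "t' \<le> t + r" "t' - s \<le> 3 * r"
      if "(x', t') \<in> D" for x' t'
    proof -
      show *: "dist x' y \<le> 4 * r" "s \<le> t'" "t' \<le> t + r"
        using that by (auto simp: D_def dist_commute)
      have R8: "R = 8 * r" by (simp add: r_def)
      have st0: "t0 < s + r" "s < t0 + r" "t < t0 + r" "t0 < t + r" using near by linarith+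
      show "dist x' x0 < R" using * dist_triangle[of x' x0 y] yx0 r unfolding R8 by linarith
      show "\<bar>t' - t0\<bar> < R" using * st0 r unfolding R8 by linarith
      show "t' - s \<le> 3 * r" using * st0 by linarith
    qed
    define U where "U = u (x0, t0)"
    have uU: "\<bar>u (x', t') - U\<bar> < 1" if "(x', t') \<in> D" for x' t'
      using R(2)[OF Din(1,2)[OF that]] by (simp add: U_def)
    have xtD: "(x, t) \<in> D" using d st near r by (auto simp: D_def dist_commute)
    have Wlow: "W (x', t') \<ge> U + 2 - K + A * (max ((dist x' y)\<^sup>2 - (t' - s)\<^sup>2 - k) 0)\<^sup>2
        + B * (max (t' - t) 0)\<^sup>2" if "(x', t') \<in> D" for x' t'
    proof -
      have "F * (t - s) \<le> \<bar>F\<bar> * (2 * r)" using near st by (intro mult_mono) auto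
      moreover have "- F * (t' - s) \<le> \<bar>F\<bar> * (3 * r)" using Din[OF that] by (intro mult_mono) auto
      moreover have "U - 1 \<le> u (x, t)" using uU[OF xtD] by linarith
      ultimately show ?thesis unfolding W K_def m_def by (simp add: algebra_simps)
    qed
    define g where "g = (\<lambda>z. u z - W z)"
    have Dcyl: "D \<subseteq> cyl T"
    proof
      fix z assume z: "z \<in> D"
      obtain x' t' where zz: "z = (x', t')" by (cases z)
      then have "dist x' x0 < R" "\<bar>t' - t0\<bar> < R" using z Din by blast+
      then show "z \<in> cyl T" using R(2)[of x' t'] zz by (simp add: cylI)
    qed
    have "continuous_on D W" unfolding W_def
      by (rule continuous_on_subset[OF continuous_on_locally_lipschitz[OF locally_lipschitz_on_cone_test] Dcyl])
    then have cont_g: "continuous_on D g"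
      unfolding g_def using continuous_on_subset[OF u Dcyl] by (intro continuous_on_diff)
    have g_bdd: "bdd_above (g ` D)"
    proof (rule bdd_aboveI2[of _ _ "K"])
      fix z assume z: "z \<in> D"
      obtain x' t' where zz: "z = (x', t')" by (cases z)
      have "0 \<le> A * (max ((dist x' y)\<^sup>2 - (t' - s)\<^sup>2 - k) 0)\<^sup>2 + B * (max (t' - t) 0)\<^sup>2"
        using A B by simp
      then show "g z \<le> K" using Wlow uU z unfolding zz g_def by force
    qed
    have gxt: "g (x, t) = 0"
    proof -
      have "(dist x y)\<^sup>2 \<le> (t - s)\<^sup>2" using d by (intro power_mono) auto
      then have "max ((dist x y)\<^sup>2 - (t - s)\<^sup>2 - k) 0 = 0" using k by simp
      then show ?thesis by (simp add: g_def W m_def)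
    qed
    have bottom: "g (x', t') < 0" if D: "(x', t') \<in> D" and "t' = s" for x' t'
    proof (cases "dist x' y < h")
      case True
      then have "\<bar>u (x', s) - u (y, s)\<bar> < m - u (y, s)"
        using k0(2)[of "(x', s)"] h Dcyl D \<open>t' = s\<close> by (auto simp: dist_Pair_Pair)
      then have "u (x', s) < m" by linarith
      also have "m \<le> W (x', s)" unfolding W using A B st by simp
      finally show ?thesis using \<open>t' = s\<close> by (simp add: g_def)
    next
      case False
      then have "h\<^sup>2 \<le> (dist x' y)\<^sup>2" using h by (intro power_mono) auto
      then have "k \<le> max ((dist x' y)\<^sup>2 - (t' - s)\<^sup>2 - k) 0" using \<open>t' = s\<close>
        by (intro max.coboundedI1) (simp add: k_def)
      then have "A * k\<^sup>2 \<le> A * (max ((dist x' y)\<^sup>2 - (t' - s)\<^sup>2 - k) 0)\<^sup>2"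
        using A k by (intro mult_left_mono power_mono) auto
      moreover have "0 \<le> B * (max (t' - t) 0)\<^sup>2" using B by simp
      ultimately show ?thesis using Wlow[OF D] uU[OF D] A by (simp add: g_def)
    qed
    have lateral: "g (x', t') < 0" if D: "(x', t') \<in> D" and "dist x' y = 4 * r" for x' t'
    proof -
      have "(t' - s)\<^sup>2 \<le> (3 * r)\<^sup>2" using Din[OF D] by (intro power_mono) auto
      then have "(dist x' y)\<^sup>2 - (t' - s)\<^sup>2 - k \<ge> 16 * r\<^sup>2 - 9 * r\<^sup>2 - k"
        using that by (simp add: power_mult_distrib)
      then have "k \<le> max ((dist x' y)\<^sup>2 - (t' - s)\<^sup>2 - k) 0" using k
        by (intro max.coboundedI1) linarith
      then have "A * k\<^sup>2 \<le> A * (max ((dist x' y)\<^sup>2 - (t' - s)\<^sup>2 - k) 0)\<^sup>2"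
        using A k by (intro mult_left_mono power_mono) auto
      moreover have "0 \<le> B * (max (t' - t) 0)\<^sup>2" using B by simp
      ultimately show ?thesis using Wlow[OF D] uU[OF D] A by (simp add: g_def)
    qed
    have top: "g (x', t') < 0" if D: "(x', t') \<in> D" and "t' = t + r" for x' t'
    proof -
      have "B * (max (t' - t) 0)\<^sup>2 = K" using B r that by simp
      moreover have "0 \<le> A * (max ((dist x' y)\<^sup>2 - (t' - s)\<^sup>2 - k) 0)\<^sup>2" using A by simp
      ultimately show ?thesis using Wlow[OF D] uU[OF D] by (simp add: g_def)
    qed
    have "closed D" "bounded (snd ` D)"
      by (auto simp: D_def closed_Times snd_image_times)
    then obtain x1 t1 where z1: "(x1, t1) \<in> D" "g (x, t) \<le> g (x1, t1)"
      "\<And>x' t'. (x', t') \<in> D \<Longrightarrow> g (x', t') \<le> g (x1, t1) + e * dist x' x1"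
      using spatial_ekeland[OF _ _ cont_g g_bdd xtD e] by metis
    have g1: "\<not> g (x1, t1) < 0" using z1 gxt by simp
    have int: "dist x1 y < 4 * r" "s < t1" "t1 < t + r"
      using Din[OF z1(1)] bottom[OF z1(1)] lateral[OF z1(1)] top[OF z1(1)] g1
      by (auto simp: order.order_iff_strict)
    have "F + 4 * A * max ((dist x1 y)\<^sup>2 - (t1 - s)\<^sup>2 - k) 0 * (dist x1 y - (t1 - s))
        + 2 * B * max (t1 - t) 0 - e \<le> f x1"
    proof (rule subsolution_inequality_at_perturbed_max[OF X sub])
      show "0 < t1" "t1 < T" using R(2) Din[OF z1(1)] by blast+
      show "open (ball y (4 * r) \<times> {s<..<t + r})" by (intro open_Times) auto
      show "(x1, t1) \<in> ball y (4 * r) \<times> {s<..<t + r}" using int by (simp add: dist_commute)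
      fix x' t' assume "(x', t') \<in> ball y (4 * r) \<times> {s<..<t + r}"
      then have "(x', t') \<in> D" by (auto simp: D_def)
      from z1(3)[OF this]
      show "u (x', t') - cone_test y s k A t B (m - F * s) F (x', t')
          \<le> u (x1, t1) - cone_test y s k A t B (m - F * s) F (x1, t1) + e * dist x' x1"
        by (simp add: g_def W_def)
    qed (use A e in auto)
    moreover have "0 \<le> max ((dist x1 y)\<^sup>2 - (t1 - s)\<^sup>2 - k) 0 * (dist x1 y - (t1 - s))"
    proof (cases "(dist x1 y)\<^sup>2 - (t1 - s)\<^sup>2 - k > 0")
      case True
      then have "(t1 - s)\<^sup>2 \<le> (dist x1 y)\<^sup>2" using k by simp
      then have "t1 - s \<le> dist x1 y" by (rule power2_le_imp_le) simp
      then show ?thesis by simp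
    qed (simp add: max_def)
    then have "0 \<le> 4 * A * max ((dist x1 y)\<^sup>2 - (t1 - s)\<^sup>2 - k) 0 * (dist x1 y - (t1 - s))"
      using A by (simp add: mult.assoc)
    moreover have "0 \<le> 2 * B * max (t1 - t) 0" using B by simp
    moreover have "f x1 < f x0 + e" using R(2)[OF Din(1,2)[OF z1(1)]] by linarith
    moreover have "F = f x0 + 2 * e" by (simp add: e_def field_simps)
    ultimately show False by linarith
  qed
qed

text \<open>A supersolution nearly attains the dynamic programming inequality for some motion of speed at
  most one. If all points within \<open>\<delta> + \<rho>\<close> of \<open>x\<close> were too high at time \<open>t - \<delta>\<close>, one compares \<open>u\<close> from
  below with \<open>- V\<close>, which grows at rate \<open>F\<close> and is penalised near the lateral boundary of the
  backward light cone with tip \<open>(x, t + \<rho>)\<close>. The penalty is a function of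
  \<open>\<rho>\<^sup>2 + d\<^sup>2 - (t + \<rho> - t')\<^sup>2\<close>, with \<open>d\<close> the distance to \<open>x\<close>: it vanishes at \<open>(x, t)\<close>, is large on the
  whole lateral boundary including the tip, and inside the cone its time derivative dominates its
  slope. The slack \<open>\<rho>\<close> is the room in which the penalty grows.\<close>

proposition supersolution_ge_along_some_motion:
  fixes f :: "'a::complete_space \<Rightarrow> real" and u :: "'a \<times> real \<Rightarrow> real"
  assumes X: "is_length_space TYPE('a)" and super: "slope_supersolution T f u"
    and u: "continuous_on (cyl T) u" and f: "continuous_on UNIV f"
    and t: "0 < t" "t < T" and F: "F < f x"
  obtains r where "r > 0"
    "\<And>\<delta> \<rho>. 0 < \<delta> \<Longrightarrow> \<delta> < r \<Longrightarrow> 0 < \<rho> \<Longrightarrow> \<rho> < r \<Longrightarrow>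
       \<exists>y. dist x y \<le> \<delta> + \<rho> \<and> u (y, t - \<delta>) + F * \<delta> \<le> u (x, t)"
proof -
  define e where "e = (f x - F) / 2"
  have e: "e > 0" using F by (simp add: e_def)
  obtain R where R: "R > 0" "\<And>x' t'. dist x' x < R \<Longrightarrow> \<bar>t' - t\<bar> < R \<Longrightarrow>
       0 < t' \<and> t' < T \<and> \<bar>f x' - f x\<bar> < e \<and> \<bar>u (x', t') - u (x, t)\<bar> < 1"
    using cyl_nbhd[OF u f t e] by metis
  define r where "r = R / 4"
  have r: "r > 0" using R by (simp add: r_def)
  show ?thesis
  proof (rule that[OF r], rule ccontr)
    fix \<delta> \<rho>
    assume \<delta>: "0 < \<delta>" "\<delta> < r" and \<rho>: "0 < \<rho>" "\<rho> < r"
      and contra: "\<nexists>y. dist x y \<le> \<delta> + \<rho> \<and> u (y, t - \<delta>) + F * \<delta> \<le> u (x, t)"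
    define U where "U = u (x, t)"
    define m where "m = U - F * \<delta>"
    have below: "m < u (y, t - \<delta>)" if "dist x y \<le> \<delta> + \<rho>" for y
      using contra that by (force simp: m_def U_def)
    \<comment> \<open>\<open>K\<close> exceeds the oscillation of \<open>u\<close> and of the affine part of \<open>V\<close>; on the lateral boundary of the
      cone the penalty equals \<open>A * (\<rho>\<^sup>2)\<^sup>2 = K\<close>.\<close>
    define K where "K = 3 + 3 * r * \<bar>F\<bar>"
    have K: "K > 0" using r by (simp add: K_def add_pos_nonneg)
    define A where "A = K / (\<rho>\<^sup>2)\<^sup>2"
    have A: "A > 0" "A * (\<rho>\<^sup>2)\<^sup>2 = K" using K \<rho> by (auto simp: A_def)
    define V where "V = cone_test x (t + \<rho>) (- \<rho>\<^sup>2) A 0 0 (F * (t - \<delta>) - m) (- F)"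
    have V: "V (x', t') = - m - F * (t' - (t - \<delta>))
        + A * (max ((dist x' x)\<^sup>2 - (t' - (t + \<rho>))\<^sup>2 + \<rho>\<^sup>2) 0)\<^sup>2" for x' t'
      by (simp add: V_def cone_test_def algebra_simps)
    define D where "D = {z. t - \<delta> \<le> snd z \<and> dist (fst z) x \<le> t + \<rho> - snd z}"
    have Din: "t - \<delta> \<le> t'" "dist x' x \<le> t + \<rho> - t'" "t' \<le> t + \<rho>" "t' - (t - \<delta>) \<le> 2 * r"
        "dist x' x < R" "\<bar>t' - t\<bar> < R"
      if "(x', t') \<in> D" for x' t'
    proof -
      show *: "t - \<delta> \<le> t'" "dist x' x \<le> t + \<rho> - t'" using that by (auto simp: D_def)
      then show **: "t' \<le> t + \<rho>" using zero_le_dist[of x' x] by linarith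
      then show "t' - (t - \<delta>) \<le> 2 * r" "dist x' x < R" "\<bar>t' - t\<bar> < R"
        using * \<delta> \<rho> by (auto simp: r_def)
    qed
    have uU: "\<bar>u (x', t') - U\<bar> < 1" if "(x', t') \<in> D" for x' t'
      using R(2)[OF Din(5,6)[OF that]] by (simp add: U_def)
    have Vlow: "V (x', t') \<ge> - U + 3 - K
        + A * (max ((dist x' x)\<^sup>2 - (t' - (t + \<rho>))\<^sup>2 + \<rho>\<^sup>2) 0)\<^sup>2" if "(x', t') \<in> D" for x' t'
    proof -
      have "- F * \<delta> \<le> \<bar>F\<bar> * r" using \<delta> by (intro mult_mono) auto
      moreover have "F * (t' - (t - \<delta>)) \<le> \<bar>F\<bar> * (2 * r)" using Din[OF that] by (intro mult_mono) auto
      ultimately show ?thesis unfolding V K_def m_def by (simp add: algebra_simps)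
    qed
    define g where "g = (\<lambda>z. - u z - V z)"
    have Dcyl: "D \<subseteq> cyl T"
    proof
      fix z assume z: "z \<in> D"
      obtain x' t' where zz: "z = (x', t')" by (cases z)
      then have "dist x' x < R" "\<bar>t' - t\<bar> < R" using z Din by blast+
      then show "z \<in> cyl T" using R(2)[of x' t'] zz by (simp add: cylI)
    qed
    have "continuous_on D V" unfolding V_def
      by (rule continuous_on_subset[OF continuous_on_locally_lipschitz[OF locally_lipschitz_on_cone_test] Dcyl])
    then have cont_g: "continuous_on D g"
      unfolding g_def using continuous_on_subset[OF u Dcyl] by (intro continuous_on_diff continuous_on_minus)
    have g_bdd: "bdd_above (g ` D)"
    proof (rule bdd_aboveI2[of _ _ "K"])
      fix z assume z: "z \<in> D"
      obtain x' t' where zz: "z = (x', t')" by (cases z)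
      have "0 \<le> A * (max ((dist x' x)\<^sup>2 - (t' - (t + \<rho>))\<^sup>2 + \<rho>\<^sup>2) 0)\<^sup>2" using A by simp
      then show "g z \<le> K" using Vlow uU z unfolding zz g_def by force
    qed
    have xtD: "(x, t) \<in> D" using \<delta> \<rho> by (simp add: D_def)
    have gxt: "g (x, t) = 0" by (simp add: g_def V m_def U_def)
    have bottom: "g (x', t') < 0" if D: "(x', t') \<in> D" and "t' = t - \<delta>" for x' t'
    proof -
      have "m < u (x', t - \<delta>)" using Din[OF D] \<open>t' = t - \<delta>\<close> by (intro below) (simp add: dist_commute)
      moreover have "- m \<le> V (x', t - \<delta>)" unfolding V using A by simp
      ultimately show ?thesis using \<open>t' = t - \<delta>\<close> by (simp add: g_def)
    qed
    have lateral: "g (x', t') < 0" if D: "(x', t') \<in> D" and "dist x' x = t + \<rho> - t'" for x' t'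
    proof -
      have "(dist x' x)\<^sup>2 = (t' - (t + \<rho>))\<^sup>2" unfolding that(2) by (simp add: power2_commute)
      then have "A * (max ((dist x' x)\<^sup>2 - (t' - (t + \<rho>))\<^sup>2 + \<rho>\<^sup>2) 0)\<^sup>2 = K" using A by simp
      then show ?thesis using Vlow[OF D] uU[OF D] by (simp add: g_def)
    qed
    have "closed D" unfolding D_def
      by (intro closed_Collect_conj closed_Collect_le continuous_intros)
    moreover have "bounded (snd ` D)"
      by (rule bounded_subset[of "{t - \<delta>..t + \<rho>}"]) (use Din in auto)
    ultimately obtain x1 t1 where z1: "(x1, t1) \<in> D" "g (x, t) \<le> g (x1, t1)"
      "\<And>x' t'. (x', t') \<in> D \<Longrightarrow> g (x', t') \<le> g (x1, t1) + e * dist x' x1"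
      using spatial_ekeland[OF _ _ cont_g g_bdd xtD e] by metis
    have g1: "\<not> g (x1, t1) < 0" using z1 gxt by simp
    have int: "t - \<delta> < t1" "dist x1 x < t + \<rho> - t1"
      using Din[OF z1(1)] bottom[OF z1(1)] lateral[OF z1(1)] g1
      by (auto simp: order.order_iff_strict)
    define N where "N = {z. t - \<delta> < snd z \<and> dist (fst z) x < t + \<rho> - snd z}"
    have "f x1 \<le> - (- F) + 4 * A * max ((dist x1 x)\<^sup>2 - (t1 - (t + \<rho>))\<^sup>2 - (- \<rho>\<^sup>2)) 0
        * (dist x1 x + (t1 - (t + \<rho>))) - 2 * 0 * max (t1 - 0) 0 + e"
    proof (rule supersolution_inequality_at_perturbed_min[OF X super])
      show "0 < t1" "t1 < T" using R(2) Din[OF z1(1)] by blast+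
      show "open N" unfolding N_def
        by (intro open_Collect_conj open_Collect_less continuous_intros)
      show "(x1, t1) \<in> N" using int by (simp add: N_def)
      fix x' t' assume "(x', t') \<in> N"
      then have "(x', t') \<in> D" by (auto simp: D_def N_def)
      from z1(3)[OF this]
      show "- u (x', t') - cone_test x (t + \<rho>) (- \<rho>\<^sup>2) A 0 0 (F * (t - \<delta>) - m) (- F) (x', t')
          \<le> - u (x1, t1) - cone_test x (t + \<rho>) (- \<rho>\<^sup>2) A 0 0 (F * (t - \<delta>) - m) (- F) (x1, t1)
            + e * dist x' x1"
        by (simp add: g_def V_def)
    qed (use A e in auto)
    moreover have "4 * A * max ((dist x1 x)\<^sup>2 - (t1 - (t + \<rho>))\<^sup>2 - (- \<rho>\<^sup>2)) 0
        * (dist x1 x + (t1 - (t + \<rho>))) \<le> 0"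
      using A int by (intro mult_nonneg_nonpos) auto
    moreover have "f x - e < f x1" using R(2)[OF Din(5,6)[OF z1(1)]] by linarith
    moreover have "F = f x - 2 * e" by (simp add: e_def field_simps)
    ultimately show False by linarith
  qed
qed

section \<open>Lower bounds in time\<close>

text \<open>The one-step estimate for supersolutions holds for step sizes that depend on the point, without
  any uniform lower bound. Completeness of the space lets the steps be chained down to time \<open>0\<close> all
  the same: the relation of being reachable at speed at most \<open>2\<close> and at cost rate at least \<open>- C\<close> is a
  closed preorder, and an element that is maximal for it cannot have positive time. At time \<open>0\<close> the
  Lipschitz bound on \<open>u0\<close> takes over.\<close>

lemma initial_lower_bound:
  fixes f u0 :: "'a::complete_space \<Rightarrow> real" and u :: "'a \<times> real \<Rightarrow> real"
  assumes X: "is_length_space TYPE('a)" and super: "slope_supersolution T f u"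
    and u: "continuous_on (UNIV \<times> {0..<T}) u" and f: "continuous_on UNIV f"
    and C: "\<And>x. - C < f x" "0 \<le> C" and L: "L-lipschitz_on UNIV u0"
    and u0: "\<And>x. u (x, 0) = u0 x" and h: "0 \<le> h" "h < T"
  shows "u0 x - (2 * L + C) * h \<le> u (x, h)"
proof -
  define D :: "('a \<times> real) set" where "D = UNIV \<times> {0..h}"
  define R where "R z w \<longleftrightarrow> w \<in> D \<and> snd w \<le> snd z \<and>
      dist (fst z) (fst w) \<le> 2 * (snd z - snd w) \<and> u w - C * (snd z - snd w) \<le> u z" for z w
  have uD: "continuous_on D u"
    using u by (rule continuous_on_subset) (use h in \<open>auto simp: D_def\<close>)
  have ucyl: "continuous_on (cyl T) u"
    using u by (rule continuous_on_subset) (auto simp: cyl_def)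
  have closedD: "closed D" by (simp add: D_def closed_Times)
  have "\<exists>z. R (x, h) z \<and> (\<forall>w. R z w \<longrightarrow> 2 * snd w = 2 * snd z)"
  proof (rule closed_preorder_maximal_element[of D R "\<lambda>z. 2 * snd z" "(x, h)"])
    show "R z z" if "z \<in> D" for z using that by (simp add: R_def)
    show "R z v" if "R z w" "R w v" for z w v
      using that dist_triangle[of "fst z" "fst v" "fst w"] by (auto simp: R_def algebra_simps)
    show "w \<in> D" if "R z w" for z w using that by (simp add: R_def)
    show "dist (fst z) (fst w) \<le> 2 * snd z - 2 * snd w" if "R z w" for z w
      using that by (simp add: R_def)
    show "closed {w. R z w}" for z
    proof -
      have "{w. R z w} = {w. snd w \<le> snd z} \<inter> {w. dist (fst z) (fst w) \<le> 2 * (snd z - snd w)}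
          \<inter> {w \<in> D. u w - C * (snd z - snd w) \<le> u z}" by (auto simp: R_def)
      also have "closed \<dots>"
        by (intro closed_Int closed_Collect_le continuous_on_closed_Collect_le closedD uD
            continuous_intros)
      finally show ?thesis .
    qed
    show "bdd_below ((\<lambda>z. 2 * snd z) ` D)"
      by (rule bdd_belowI2[of _ 0]) (auto simp: D_def)
    show "bounded (snd ` D)" by (simp add: D_def snd_image_times)
    show "(x, h) \<in> D" using h by (simp add: D_def)
  qed blast
  then obtain x' t' where z: "R (x, h) (x', t')" "\<And>w. R (x', t') w \<Longrightarrow> snd w = t'" by force
  then have t': "0 \<le> t'" "t' \<le> h" by (auto simp: R_def D_def)
  have "t' = 0"
  proof (rule ccontr)
    assume "t' \<noteq> 0"
    then have t0: "0 < t'" "t' < T" using t' h by auto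
    obtain r where r: "r > 0" "\<And>\<delta> \<rho>. 0 < \<delta> \<Longrightarrow> \<delta> < r \<Longrightarrow> 0 < \<rho> \<Longrightarrow> \<rho> < r \<Longrightarrow>
       \<exists>y. dist x' y \<le> \<delta> + \<rho> \<and> u (y, t' - \<delta>) + (- C) * \<delta> \<le> u (x', t')"
      using supersolution_ge_along_some_motion[OF X super ucyl f t0, of "- C" x'] C(1) by metis
    define \<delta> where "\<delta> = min (r / 2) t'"
    have \<delta>: "0 < \<delta>" "\<delta> < r" "\<delta> \<le> t'" using r(1) t0 by (auto simp: \<delta>_def)
    obtain y where y: "dist x' y \<le> \<delta> + \<delta>" "u (y, t' - \<delta>) + (- C) * \<delta> \<le> u (x', t')"
      using r(2)[OF \<delta>(1,2) \<delta>(1,2)] by blast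
    have "R (x', t') (y, t' - \<delta>)" using y \<delta> t' by (simp add: R_def D_def)
    then show False using z(2) \<delta>(1) by force
  qed
  then have *: "dist x x' \<le> 2 * h" "u0 x' - C * h \<le> u (x, h)"
    using z(1) by (auto simp: R_def u0)
  have "\<bar>u0 x - u0 x'\<bar> \<le> L * dist x x'"
    using lipschitz_onD[OF L, of x x'] by (simp add: dist_real_def)
  also have "\<dots> \<le> L * (2 * h)" using * lipschitz_on_nonneg[OF L] by (intro mult_left_mono)
  finally show ?thesis using * by (simp add: algebra_simps abs_le_iff)
qed

text \<open>Compare \<open>u\<close> with its own time shift along one backward chain of points \<open>(x\<^sub>i, t\<^sub>i)\<close> from \<open>(x, t)\<close>.
  The supersolution property provides the chain and bounds the decrease of \<open>u\<close> along it from below;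
  the subsolution property bounds the decrease of \<open>u\<close> along the shifted times \<open>\<sigma> t\<^sub>i\<close> from above. Both
  bounds use the same values of \<open>f\<close>, so they cancel up to small errors. The supersolution estimate
  loses a factor \<open>q = 1 + e\<close> in speed, hence the shifted clock has to run \<open>q\<close> times as fast to keep
  up. It starts from \<open>\<sigma> t = s\<close> and reaches \<open>0\<close> when the original clock shows \<open>a\<close>, close to \<open>t - s\<close>;
  there the comparison reduces to the lower bound near the initial time.\<close>

proposition time_lower_bound:
  fixes f u0 :: "'a::complete_space \<Rightarrow> real" and u :: "'a \<times> real \<Rightarrow> real"
  assumes X: "is_length_space TYPE('a)"
    and sub: "slope_subsolution T f u" and super: "slope_supersolution T f u"
    and u: "continuous_on (UNIV \<times> {0..<T}) u" and f: "continuous_on UNIV f"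
    and C: "\<And>x. \<bar>f x\<bar> < C" and L: "L-lipschitz_on UNIV u0"
    and u0: "\<And>x. u (x, 0) = u0 x" and st: "0 < s" "s < t" "t < T"
  shows "- (2 * L + C) * (t - s) \<le> u (x, t) - u (x, s)"
proof -
  define k where "k = 2 * L + C"
  have C0: "0 \<le> C" using C[of x] by linarith
  have k0: "0 \<le> k" using C0 lipschitz_on_nonneg[OF L] by (simp add: k_def)
  have Clow: "- C < f y" for y using C[of y] by linarith
  have ucyl: "continuous_on (cyl T) u"
    using u by (rule continuous_on_subset) (auto simp: cyl_def)
  have main: "- k * (t - s) \<le> u (x, t) - u (x, s) + e * (k * s + (3 + C) * t)"
    if e: "0 < e" "e < 1" for e
  proof -
    define q where "q = 1 + e"
    \<comment> \<open>the time at which the shifted clock \<open>\<sigma>\<close> stops\<close>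
    define a where "a = t - s / q"
    define \<sigma> where "\<sigma> r = s - q * (t - r)" for r
    define \<eta> where "\<eta> = e * (3 + C)"
    have q: "q > 1" using e by (simp add: q_def)
    have sq: "s / q < s" "0 < s / q" using q st by (auto simp: divide_less_eq)
    have a: "t - s < a" "a < t" using sq by (auto simp: a_def)
    have \<sigma>a: "\<sigma> a = 0" using q by (simp add: \<sigma>_def a_def)
    have \<sigma>_mono: "0 \<le> \<sigma> r" "\<sigma> r \<le> s" if "a \<le> r" "r \<le> t" for r
    proof -
      have "q * (t - r) \<le> q * (t - a)" using that q by (intro mult_left_mono) auto
      also have "\<dots> = s" using q by (simp add: a_def)
      finally show "0 \<le> \<sigma> r" by (simp add: \<sigma>_def)
      show "\<sigma> r \<le> s" using that q by (simp add: \<sigma>_def)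
    qed
    define \<Phi> where "\<Phi> z = u z - u (fst z, \<sigma> (snd z))" for z
    define D :: "('a \<times> real) set" where "D = UNIV \<times> {a..t}"
    define R where "R z w \<longleftrightarrow> w \<in> D \<and> snd w \<le> snd z \<and>
      dist (fst z) (fst w) \<le> q * (snd z - snd w) \<and> \<Phi> w - \<eta> * (snd z - snd w) \<le> \<Phi> z" for z w
    have closedD: "closed D" by (simp add: D_def closed_Times)
    have contD: "continuous_on D \<Phi>"
    proof -
      have "continuous_on D u"
        using u by (rule continuous_on_subset) (use a st in \<open>auto simp: D_def\<close>)
      moreover have "continuous_on D (\<lambda>z. u (fst z, \<sigma> (snd z)))"
      proof (rule continuous_on_compose2[OF u])
        show "continuous_on D (\<lambda>z. (fst z, \<sigma> (snd z)))"
          unfolding \<sigma>_def by (intro continuous_intros)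
        show "(\<lambda>z. (fst z, \<sigma> (snd z))) ` D \<subseteq> UNIV \<times> {0..<T}"
        proof (rule image_subsetI)
          fix z assume "z \<in> D"
          then have "a \<le> snd z" "snd z \<le> t" by (auto simp: D_def)
          from \<sigma>_mono[OF this] show "(fst z, \<sigma> (snd z)) \<in> UNIV \<times> {0..<T}" using st by simp
        qed
      qed
      ultimately show ?thesis unfolding \<Phi>_def by (intro continuous_on_diff)
    qed
    have "\<exists>z. R (x, t) z \<and> (\<forall>w. R z w \<longrightarrow> q * snd w = q * snd z)"
    proof (rule closed_preorder_maximal_element[of D R "\<lambda>z. q * snd z" "(x, t)"])
      show "R z z" if "z \<in> D" for z using that by (simp add: R_def)
      show "R z v" if "R z w" "R w v" for z w v
        using that dist_triangle[of "fst z" "fst v" "fst w"] by (auto simp: R_def algebra_simps)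
      show "w \<in> D" if "R z w" for z w using that by (simp add: R_def)
      show "dist (fst z) (fst w) \<le> q * snd z - q * snd w" if "R z w" for z w
        using that by (simp add: R_def algebra_simps)
      show "closed {w. R z w}" for z
      proof -
        have "{w. R z w} = {w. snd w \<le> snd z} \<inter> {w. dist (fst z) (fst w) \<le> q * (snd z - snd w)}
            \<inter> {w \<in> D. \<Phi> w - \<eta> * (snd z - snd w) \<le> \<Phi> z}" by (auto simp: R_def)
        also have "closed \<dots>"
          by (intro closed_Int closed_Collect_le continuous_on_closed_Collect_le closedD contD
              continuous_intros)
        finally show ?thesis .
      qed
      show "bdd_below ((\<lambda>z. q * snd z) ` D)"
        by (rule bdd_belowI2[of _ "q * a"]) (use q in \<open>auto simp: D_def\<close>)
      show "bounded (snd ` D)" by (simp add: D_def snd_image_times)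
      show "(x, t) \<in> D" using a by (simp add: D_def)
    qed blast
    then obtain x' t' where z: "R (x, t) (x', t')" "\<And>w. R (x', t') w \<Longrightarrow> snd w = t'"
      using q by force
    then have t': "a \<le> t'" "t' \<le> t" by (auto simp: R_def D_def)
    have "t' = a"
    proof (rule ccontr)
      assume "t' \<noteq> a"
      then have at: "a < t'" using t' by simp
      have t0: "0 < t'" "t' < T" using at t' a st by auto
      define s' where "s' = \<sigma> t'"
      have "q * (t' - a) > 0" using at q by simp
      moreover have "s' = q * (t' - a)" using q by (simp add: s'_def \<sigma>_def a_def field_simps)
      ultimately have s0: "0 < s'" "s' < T"
        using \<sigma>_mono(2)[OF t'] st by (auto simp: s'_def)
      obtain r1 where r1: "r1 > 0" "\<And>\<delta> \<rho>. 0 < \<delta> \<Longrightarrow> \<delta> < r1 \<Longrightarrow> 0 < \<rho> \<Longrightarrow> \<rho> < r1 \<Longrightarrow>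
         \<exists>y. dist x' y \<le> \<delta> + \<rho> \<and> u (y, t' - \<delta>) + (f x' - e) * \<delta> \<le> u (x', t')"
        using supersolution_ge_along_some_motion[OF X super ucyl f t0, of "f x' - e" x'] e by auto
      obtain r2 where r2: "r2 > 0" "\<And>x y s t. dist x x' < r2 \<Longrightarrow> \<bar>s - s'\<bar> < r2 \<Longrightarrow>
         \<bar>t - s'\<bar> < r2 \<Longrightarrow> dist x y \<le> t - s \<Longrightarrow> u (x, t) \<le> u (y, s) + (f x' + e) * (t - s)"
        using subsolution_le_along_motion[OF X sub ucyl f s0, of x' "f x' + e"] e by auto
      define \<delta> where "\<delta> = min (min (r1 / 2) (r2 / (2 * q))) (t' - a)"
      have \<delta>: "0 < \<delta>" "\<delta> < r1" "\<delta> \<le> t' - a" "q * \<delta> < r2"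
      proof -
        show "0 < \<delta>" "\<delta> < r1" "\<delta> \<le> t' - a" using r1(1) r2(1) at q by (auto simp: \<delta>_def)
        have "\<delta> \<le> r2 / (2 * q)" by (simp add: \<delta>_def)
        then have "q * \<delta> \<le> r2 / 2" using q by (simp add: field_simps)
        then show "q * \<delta> < r2" using r2(1) by simp
      qed
      have "e * \<delta> < 1 * r1" using e \<delta> by (intro mult_strict_mono) auto
      then obtain y where y: "dist x' y \<le> \<delta> + e * \<delta>"
          "u (y, t' - \<delta>) + (f x' - e) * \<delta> \<le> u (x', t')"
        using r1(2)[of \<delta> "e * \<delta>"] \<delta> e by auto
      have yq: "dist x' y \<le> q * \<delta>" using y(1) by (simp add: q_def algebra_simps)
      have "u (x', s') \<le> u (y, s' - q * \<delta>) + (f x' + e) * (s' - (s' - q * \<delta>))"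
        using yq \<delta> q r2(1) by (intro r2(2)) auto
      moreover have "\<sigma> (t' - \<delta>) = s' - q * \<delta>" by (simp add: s'_def \<sigma>_def algebra_simps)
      ultimately have "\<Phi> (y, t' - \<delta>) \<le> \<Phi> (x', t') + ((f x' + e) * (q * \<delta>) - (f x' - e) * \<delta>)"
        using y(2) by (simp add: \<Phi>_def s'_def)
      moreover have "(f x' + e) * (q * \<delta>) - (f x' - e) * \<delta> \<le> \<eta> * \<delta>"
      proof -
        have "e * f x' \<le> e * C" using C[of x'] e by (intro mult_left_mono) auto
        moreover have "e * e \<le> e * 1" using e by (intro mult_left_mono) auto
        ultimately have "- (f x' - e) + (f x' + e) * q \<le> \<eta>"
          by (simp add: q_def \<eta>_def algebra_simps)
        then have "(- (f x' - e) + (f x' + e) * q) * \<delta> \<le> \<eta> * \<delta>"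
          using \<delta>(1) by (intro mult_right_mono) auto
        then show ?thesis by (simp add: algebra_simps)
      qed
      ultimately have "R (x', t') (y, t' - \<delta>)"
        using yq \<delta> t' by (simp add: R_def D_def)
      then show False using z(2) \<delta>(1) by force
    qed
    then have "\<Phi> (x', a) - \<eta> * (t - a) \<le> \<Phi> (x, t)" using z(1) by (simp add: R_def)
    moreover have "\<Phi> (x, t) = u (x, t) - u (x, s)" by (simp add: \<Phi>_def \<sigma>_def)
    moreover have "\<Phi> (x', a) = u (x', a) - u0 x'" by (simp add: \<Phi>_def \<sigma>a u0)
    moreover have "u0 x' - k * a \<le> u (x', a)"
      unfolding k_def by (rule initial_lower_bound[OF X super u f Clow C0 L u0]) (use a st in auto)
    ultimately have low: "- k * a - \<eta> * (t - a) \<le> u (x, t) - u (x, s)" by simp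
    have "a - (t - s) = e * (s / q)" using q by (simp add: a_def q_def field_simps)
    also have "\<dots> \<le> e * s" using sq e by (intro mult_left_mono) auto
    finally have "k * a \<le> k * (t - s + e * s)" using k0 by (intro mult_left_mono) auto
    moreover have "\<eta> * (t - a) \<le> \<eta> * t"
      using a st e C0 by (intro mult_left_mono) (auto simp: \<eta>_def)
    ultimately show ?thesis using low by (simp add: \<eta>_def algebra_simps)
  qed
  define M where "M = k * s + (3 + C) * t"
  have "((\<lambda>e. u (x, t) - u (x, s) + e * M) \<longlongrightarrow> u (x, t) - u (x, s) + 0 * M) (at_right 0)"
    by (intro tendsto_intros)
  moreover have "\<forall>\<^sub>F e in at_right 0. - k * (t - s) \<le> u (x, t) - u (x, s) + e * M"
    unfolding eventually_at_right_field
    by (intro exI[of _ 1]) (use main in \<open>auto simp: M_def\<close>)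
  ultimately have "- k * (t - s) \<le> u (x, t) - u (x, s) + 0 * M"
    by (rule tendsto_lowerbound) simp
  then show ?thesis by (simp add: k_def)
qed

section \<open>Slope-based solutions are Monge solutions\<close>

text \<open>To go from \<open>(x, t)\<close> to \<open>(y, s)\<close>, spend the time \<open>d = dist x y\<close> on moving to \<open>y\<close>, which the
  subsolution property allows at bounded cost, and then wait at \<open>y\<close>: backwards at bounded cost by the
  subsolution property, forwards at bounded cost by the lower bound in time.\<close>

lemma locally_lipschitz_of_time_lower_bound:
  fixes f :: "'a::complete_space \<Rightarrow> real" and u :: "'a \<times> real \<Rightarrow> real"
  assumes X: "is_length_space TYPE('a)" and sub: "slope_subsolution T f u"
    and u: "continuous_on (cyl T) u" and f: "continuous_on UNIV f"
    and low: "\<And>x s t. 0 < s \<Longrightarrow> s < t \<Longrightarrow> t < T \<Longrightarrow> - k * (t - s) \<le> u (x, t) - u (x, s)"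
    and k: "0 \<le> k"
  shows "locally_lipschitz_on (cyl T) u"
proof (rule locally_lipschitz_onI)
  fix z0 :: "'a \<times> real" assume "z0 \<in> cyl T"
  then obtain x0 t0 where z0: "z0 = (x0, t0)" "0 < t0" "t0 < T" by (auto simp: cyl_def)
  define F where "F = f x0 + 1"
  obtain r where r: "r > 0"
    "\<And>x y s t. dist x x0 < r \<Longrightarrow> \<bar>s - t0\<bar> < r \<Longrightarrow> \<bar>t - t0\<bar> < r \<Longrightarrow> dist x y \<le> t - s \<Longrightarrow>
       u (x, t) \<le> u (y, s) + F * (t - s)"
    using subsolution_le_along_motion[OF X sub u f z0(2,3), of x0 F] by (auto simp: F_def)
  define \<rho> where "\<rho> = min (r / 4) (t0 / 4)"
  have \<rho>: "\<rho> > 0" "4 * \<rho> \<le> r" "4 * \<rho> \<le> t0" using r(1) z0 by (auto simp: \<rho>_def)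
  have one_sided: "u w - u w' \<le> (2 * (\<bar>F\<bar> + k)) * dist w w'"
    if w: "w \<in> ball z0 \<rho> \<inter> cyl T" "w' \<in> ball z0 \<rho> \<inter> cyl T" for w w'
  proof -
    obtain x t where wx: "w = (x, t)" by (cases w)
    obtain y s where wy: "w' = (y, s)" by (cases w')
    have near: "dist x x0 < \<rho>" "\<bar>t - t0\<bar> < \<rho>" "dist y x0 < \<rho>" "\<bar>s - t0\<bar> < \<rho>" "s < T" "0 < s"
      using w dist_fst_le[of w z0] dist_snd_le[of w z0] dist_fst_le[of w' z0] dist_snd_le[of w' z0]
      by (auto simp: wx wy z0 dist_commute dist_real_def cyl_def)
    define d where "d = dist x y"
    have d: "0 \<le> d" "d < 2 * \<rho>"
      using dist_triangle[of x y x0] near by (auto simp: d_def dist_commute)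
    have "u (x, t) \<le> u (y, t - d) + F * (t - (t - d))"
      by (intro r(2)) (use near d \<rho> d_def in linarith)+
    moreover have "F * d \<le> \<bar>F\<bar> * d" using d by (intro mult_right_mono) auto
    moreover have "u (y, t - d) - u (y, s) \<le> (\<bar>F\<bar> + k) * \<bar>t - s\<bar> + k * d"
    proof -
      have nn: "0 \<le> \<bar>F\<bar> * \<bar>t - s\<bar>" "0 \<le> k * \<bar>t - s\<bar>" "0 \<le> k * d" using k d by auto
      consider "t - d < s" | "t - d = s" | "s < t - d" by linarith
      then show ?thesis
      proof cases
        case 1
        then have "- k * (s - (t - d)) \<le> u (y, s) - u (y, t - d)"
          using near d \<rho> by (intro low) auto
        then have "- (k * (s - (t - d))) \<le> u (y, s) - u (y, t - d)" by simp
        moreover have "k * (s - (t - d)) \<le> k * (\<bar>t - s\<bar> + d)" using k by (intro mult_left_mono) auto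
        ultimately show ?thesis
          using nn unfolding distrib_left distrib_right by linarith
      next
        case 2
        then show ?thesis using nn by (simp add: algebra_simps)
      next
        case 3
        then have "u (y, t - d) \<le> u (y, s) + F * (t - d - s)"
          using near d \<rho> by (intro r(2)) auto
        moreover have "F * (t - d - s) \<le> \<bar>F\<bar> * \<bar>t - s\<bar>" using 3 d by (intro mult_mono) auto
        ultimately show ?thesis using nn by (simp add: algebra_simps)
      qed
    qed
    ultimately have "u w - u w' \<le> (\<bar>F\<bar> + k) * (d + \<bar>t - s\<bar>)"
      by (simp add: wx wy algebra_simps)
    also have "\<dots> \<le> (\<bar>F\<bar> + k) * (2 * dist w w')"
      using dist_fst_le[of w w'] dist_snd_le[of w w'] k
      by (intro mult_left_mono) (auto simp: wx wy d_def dist_real_def)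
    finally show ?thesis by (simp add: algebra_simps)
  qed
  show "\<exists>r>0. \<exists>L. \<forall>w\<in>ball z0 r \<inter> cyl T. \<forall>w'\<in>ball z0 r \<inter> cyl T. \<bar>u w - u w'\<bar> \<le> L * dist w w'"
  proof (intro exI conjI ballI)
    show "\<rho> > 0" by (rule \<rho>)
    fix w w' assume "w \<in> ball z0 \<rho> \<inter> cyl T" "w' \<in> ball z0 \<rho> \<inter> cyl T"
    from one_sided[OF this] one_sided[OF this(2,1)]
    show "\<bar>u w - u w'\<bar> \<le> (2 * (\<bar>F\<bar> + k)) * dist w w'" by (simp add: abs_le_iff dist_commute)
  qed
qed

lemma Dminus_le_of_subsolution:
  fixes f :: "'a::complete_space \<Rightarrow> real" and u :: "'a \<times> real \<Rightarrow> real"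
  assumes X: "is_length_space TYPE('a)" and sub: "slope_subsolution T f u"
    and u: "continuous_on (cyl T) u" and f: "continuous_on UNIV f" and t: "0 < t" "t < T"
  shows "Dminus u x t \<le> ereal (f x)"
  unfolding Dminus_le_iff
proof (intro allI impI)
  fix e :: real assume "e > 0"
  then obtain r where r: "r > 0" "\<And>x' y s t'. dist x' x < r \<Longrightarrow> \<bar>s - t\<bar> < r \<Longrightarrow> \<bar>t' - t\<bar> < r \<Longrightarrow>
      dist x' y \<le> t' - s \<Longrightarrow> u (x', t') \<le> u (y, s) + (f x + e) * (t' - s)"
    using subsolution_le_along_motion[OF X sub u f t, of x "f x + e"] by auto
  show "\<forall>\<^sub>F \<delta> in at_right 0. \<forall>y\<in>cball x \<delta>. u (x, t) - u (y, t - \<delta>) \<le> (f x + e) * \<delta>"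
    unfolding eventually_at_right_field
  proof (intro exI[of _ r] conjI allI impI ballI)
    fix \<delta> y assume "0 < \<delta>" "\<delta> < r" "y \<in> cball x \<delta>"
    then show "u (x, t) - u (y, t - \<delta>) \<le> (f x + e) * \<delta>"
      using r(2)[of x "t - \<delta>" t y] by simp
  qed (use r in simp)
qed

text \<open>The supersolution estimate yields a point within \<open>(1 + \<epsilon>) \<delta>\<close> at time \<open>t - \<delta>\<close>. The backward
  derivative asks for a point at unit speed, so one goes further back, to the time \<open>t - \<delta>'\<close> with
  \<open>\<delta>' = (1 + \<epsilon>) \<delta>\<close>; the lower bound in time makes the loss at most \<open>k \<epsilon> \<delta>\<close>.\<close>

lemma le_Dminus_of_supersolution:
  fixes f :: "'a::complete_space \<Rightarrow> real" and u :: "'a \<times> real \<Rightarrow> real"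
  assumes X: "is_length_space TYPE('a)" and super: "slope_supersolution T f u"
    and u: "continuous_on (cyl T) u" and f: "continuous_on UNIV f" and t: "0 < t" "t < T"
    and low: "\<And>x s t. 0 < s \<Longrightarrow> s < t \<Longrightarrow> t < T \<Longrightarrow> - k * (t - s) \<le> u (x, t) - u (x, s)"
    and k: "0 \<le> k"
  shows "ereal (f x) \<le> Dminus u x t"
  unfolding le_Dminus_iff
proof (intro allI impI)
  fix e :: real assume e: "e > 0"
  \<comment> \<open>The error \<open>e = \<epsilon> * b\<close> pays for the slack \<open>\<epsilon>\<close> in the rate, the waiting cost \<open>k * \<epsilon>\<close> and the factor \<open>1 + \<epsilon>\<close>.\<close>
  define b where "b = 1 + k + \<bar>f x\<bar>"
  define \<epsilon> where "\<epsilon> = e / b"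
  have b: "b > 0" using k by (simp add: b_def)
  have \<epsilon>: "\<epsilon> > 0" "\<epsilon> * b = e" using e b by (auto simp: \<epsilon>_def)
  obtain r where r: "r > 0" "\<And>\<delta> \<rho>. 0 < \<delta> \<Longrightarrow> \<delta> < r \<Longrightarrow> 0 < \<rho> \<Longrightarrow> \<rho> < r \<Longrightarrow>
       \<exists>y. dist x y \<le> \<delta> + \<rho> \<and> u (y, t - \<delta>) + (f x - \<epsilon>) * \<delta> \<le> u (x, t)"
    using supersolution_ge_along_some_motion[OF X super u f t, of "f x - \<epsilon>" x] \<epsilon> by auto
  have "\<forall>\<^sub>F \<delta>' in at_right 0. \<exists>y\<in>cball x \<delta>'. (f x - e) * \<delta>' < u (x, t) - u (y, t - \<delta>')"
    unfolding eventually_at_right_field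
  proof (intro exI[of _ "min (min r (r / \<epsilon>)) t"] conjI allI impI)
    show "0 < min (min r (r / \<epsilon>)) t" using r(1) \<epsilon> t by simp
    fix \<delta>' assume \<delta>': "0 < \<delta>'" "\<delta>' < min (min r (r / \<epsilon>)) t"
    define \<delta> where "\<delta> = \<delta>' / (1 + \<epsilon>)"
    have "\<delta> * (1 + \<epsilon>) = \<delta>'" using \<epsilon>(1) by (simp add: \<delta>_def)
    then have "\<delta>' = \<delta> + \<epsilon> * \<delta>" by (simp add: distrib_left mult.commute)
    moreover have "0 < \<delta>" using \<delta>'(1) \<epsilon>(1) by (simp add: \<delta>_def)
    ultimately have \<delta>: "0 < \<delta>" "\<delta>' = \<delta> + \<epsilon> * \<delta>" by blast+
    have "0 < \<epsilon> * \<delta>" using \<delta> \<epsilon> by simp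
    then have \<delta>2: "\<delta> < \<delta>'" using \<delta> by linarith
    have "\<epsilon> * \<delta> < \<epsilon> * (r / \<epsilon>)" using \<delta>' \<delta>2 \<epsilon> by (intro mult_strict_left_mono) auto
    then have "\<epsilon> * \<delta> < r" using \<epsilon> by simp
    then obtain y where y: "dist x y \<le> \<delta> + \<epsilon> * \<delta>" "u (y, t - \<delta>) + (f x - \<epsilon>) * \<delta> \<le> u (x, t)"
      using r(2)[of \<delta> "\<epsilon> * \<delta>"] \<delta> \<delta>2 \<delta>' \<open>0 < \<epsilon> * \<delta>\<close> by auto
    have "- k * (t - \<delta> - (t - \<delta>')) \<le> u (y, t - \<delta>) - u (y, t - \<delta>')"
      using \<delta>2 \<delta>' \<delta>(1) t by (intro low) auto
    then have ge: "(f x - \<epsilon> - k * \<epsilon>) * \<delta> \<le> u (x, t) - u (y, t - \<delta>')"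
      using y(2) \<delta>(2) by (simp add: algebra_simps)
    have "(f x - e) * \<delta>' = (f x + \<epsilon> * f x - e - \<epsilon> * e) * \<delta>"
      unfolding \<delta>(2) by (simp add: algebra_simps)
    also have "\<dots> < (f x - \<epsilon> - k * \<epsilon>) * \<delta>"
    proof (intro mult_strict_right_mono \<delta>(1))
      have "\<epsilon> * f x \<le> \<epsilon> * \<bar>f x\<bar>" using \<epsilon> by (intro mult_left_mono) auto
      moreover have "\<epsilon> + \<epsilon> * k + \<epsilon> * \<bar>f x\<bar> = e" using \<epsilon>(2) by (simp add: b_def algebra_simps)
      moreover have "0 < \<epsilon> * e" using \<epsilon> e by simp
      ultimately show "f x + \<epsilon> * f x - e - \<epsilon> * e < f x - \<epsilon> - k * \<epsilon>" by (simp add: algebra_simps)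
    qed
    finally have "(f x - e) * \<delta>' < u (x, t) - u (y, t - \<delta>')" using ge by linarith
    moreover have "y \<in> cball x \<delta>'" using y(1) \<delta>(2) by simp
    ultimately show "\<exists>y\<in>cball x \<delta>'. (f x - e) * \<delta>' < u (x, t) - u (y, t - \<delta>')" by blast
  qed
  then show "\<exists>\<^sub>F \<delta>' in at_right 0. \<exists>y\<in>cball x \<delta>'. (f x - e) * \<delta>' < u (x, t) - u (y, t - \<delta>')"
    by (rule eventually_frequently[rotated]) simp
qed

lemma initial_value:
  fixes u :: "'a::metric_space \<times> real \<Rightarrow> real"
  assumes "T > 0" "continuous_on (UNIV \<times> {0..<T}) u"
    and "((\<lambda>t. SUP x. ereal \<bar>u (x, t) - u0 x\<bar>) \<longlongrightarrow> 0) (at_right 0)"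
  shows "u (x, 0) = u0 x"
proof -
  have "((\<lambda>t. ereal \<bar>u (x, t) - u0 x\<bar>) \<longlongrightarrow> 0) (at_right 0)"
  proof (rule tendsto_sandwich[OF _ _ tendsto_const assms(3)])
    show "\<forall>\<^sub>F t in at_right 0. ereal \<bar>u (x, t) - u0 x\<bar> \<le> (SUP x. ereal \<bar>u (x, t) - u0 x\<bar>)"
      by (intro always_eventually allI SUP_upper) simp
  qed simp
  then have "((\<lambda>t. \<bar>u (x, t) - u0 x\<bar>) \<longlongrightarrow> 0) (at_right 0)"
    by (simp add: zero_ereal_def)
  moreover have "((\<lambda>t. \<bar>u (x, t) - u0 x\<bar>) \<longlongrightarrow> \<bar>u (x, 0) - u0 x\<bar>) (at_right 0)"
  proof -
    have "continuous_on {0..<T} (\<lambda>t. u (x, t))"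
      by (rule continuous_on_compose2[OF assms(2)]) (auto intro!: continuous_intros)
    then have "((\<lambda>t. u (x, t)) \<longlongrightarrow> u (x, 0)) (at 0 within {0..<T})"
      using assms(1) by (simp add: continuous_on_def)
    then have "((\<lambda>t. u (x, t)) \<longlongrightarrow> u (x, 0)) (at 0 within {0..T / 2})"
      by (rule tendsto_within_subset) (use assms(1) in auto)
    then have "((\<lambda>t. u (x, t)) \<longlongrightarrow> u (x, 0)) (at_right 0)"
      using assms(1) by (simp add: at_within_Icc_at_right)
    then show ?thesis by (intro tendsto_intros)
  qed
  ultimately have "0 = \<bar>u (x, 0) - u0 x\<bar>"
    by (intro tendsto_unique[of "at_right (0::real)"]) auto
  then show ?thesis by simp
qed

theorem theorem5p6:
  fixes f u0 :: "'a::complete_space \<Rightarrow> real"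
    and u :: "'a \<times> real \<Rightarrow> real"
    and T :: real
  assumes "is_length_space TYPE('a)"
    and "T > 0"
    and "bounded (range f)" and "uniformly_continuous_on UNIV f"
    and "bounded (range u0)" and "\<exists>L. L-lipschitz_on UNIV u0"
    and "continuous_on (UNIV \<times> {0..<T}) u"
    and "((\<lambda>t. SUP x. ereal \<bar>u (x, t) - u0 x\<bar>) \<longlongrightarrow> 0) (at_right 0)"
  shows "monge_solution T f u \<longleftrightarrow> slope_solution T f u"
proof
  assume "monge_solution T f u"
  then obtain k where k: "u \<in> monge_class_k T k"
    "\<forall>x. \<forall>t\<in>{0<..<T}. Dminus (\<lambda>(y, s). u (y, s) + k * s) x t = ereal (f x + k)"
    by (auto simp: monge_solution_def)
  show "slope_solution T f u"
  proof (rule slope_solution_of_Dminus_eq)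
    show "locally_lipschitz_on (cyl T) u" using k(1) by (simp add: monge_class_k_def)
    fix x t assume "0 < t" "t < T"
    then have "Dminus (\<lambda>(y, s). u (y, s) + k * s) x t = ereal (f x + k)" using k(2) by simp
    then show "Dminus u x t = ereal (f x)"
      using Dminus_add_linear_le_iff[of u k x t "f x"] le_Dminus_add_linear_iff[of "f x" k u x t]
      by (intro antisym) simp_all
  qed
next
  assume sol: "slope_solution T f u"
  then have sub: "slope_subsolution T f u" and super: "slope_supersolution T f u"
    and u: "continuous_on (cyl T) u"
    by (auto simp: slope_solution_def)
  have f: "continuous_on UNIV f" using assms(4) by (rule uniformly_continuous_imp_continuous)
  obtain L where L: "L-lipschitz_on UNIV u0" using assms(6) by blast
  obtain C where le_C: "\<And>x. \<bar>f x\<bar> \<le> C" using assms(3) by (auto simp: bounded_iff)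
  have C: "\<bar>f x\<bar> < C + 1" for x using le_C[of x] by linarith
  define k where "k = 2 * L + (C + 1)"
  have k: "0 \<le> k" using lipschitz_on_nonneg[OF L] C[of undefined] by (simp add: k_def)
  have low: "- k * (t - s) \<le> u (x, t) - u (x, s)" if "0 < s" "s < t" "t < T" for x s t
    unfolding k_def
    by (rule time_lower_bound[OF assms(1) sub super assms(7) f C L initial_value[OF assms(2,7,8)] that])
  have lip: "locally_lipschitz_on (cyl T) u"
    by (rule locally_lipschitz_of_time_lower_bound[OF assms(1) sub u f low k])
  have D: "Dminus u x t = ereal (f x)" if "0 < t" "t < T" for x t
    using Dminus_le_of_subsolution[OF assms(1) sub u f that]
      le_Dminus_of_supersolution[OF assms(1) super u f that low k] by (rule antisym)
  have cls: "u \<in> monge_class_k T k'" if "k \<le> k'" for k'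
  proof -
    have "- k' * (t - s) \<le> u (x, t) - u (x, s)" if "0 < s" "s < t" "t < T" for x s t
    proof -
      have "k * (t - s) \<le> k' * (t - s)" using \<open>k \<le> k'\<close> that by (intro mult_right_mono) auto
      then show ?thesis using low[OF that, of x] by simp
    qed
    then show ?thesis using lip by (auto simp: monge_class_k_def)
  qed
  define K where "K = max k (- (INF x. f x))"
  have K: "k \<le> K" "0 \<le> K" "0 \<le> K + (INF x. f x)" using k by (auto simp: K_def)
  have DK: "Dminus (\<lambda>(y, s). u (y, s) + K * s) x t = ereal (f x + K)" if "0 < t" "t < T" for x t
    using D[OF that, of x] Dminus_add_linear_le_iff[of u K x t "f x"]
      le_Dminus_add_linear_iff[of "f x" K u x t] by (intro antisym) simp_all
  show "monge_solution T f u"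
    unfolding monge_solution_def monge_class_def
    using K cls[OF K(1)] DK by auto
qed

end
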